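(* Let $n\ge3$ and let $L$ be a non-nilpotent solvable Leibniz superalgebra whose nilradical is the superalgebra $M(0,\dots,0)$ defined in the context. Then $L$ is isomorphic to the superalgebra $SM$ with even basis $e_1,\dots,e_n,x$, odd basis $y_1,\dots,y_n$ and products (omitted products of basis elements are zero) $$SM:\ \begin{aligned} &[e_1,e_1]=e_3,\quad [e_i,e_1]=e_{i+1}\ (2\le i\le n-1),\quad [y_j,e_1]=y_{j+1}\ (1\le j\le n-1),\\ &[e_1,y_1]=\tfrac12y_2,\quad [e_i,y_1]=\tfrac12y_i\ (2\le i\le n),\\ &[y_1,y_1]=e_1,\quad [y_j,y_1]=e_{j+1}\ (2\le j\le n-1),\\ &[e_1,x]=2e_1,\quad [e_i,x]=2(i-1)e_i\ (2\le i\le n),\quad [y_i,x]=(2i-1)y_i\ (1\le i\le n),\\ &[x,e_1]=-2e_1,\quad [x,y_1]=-y_1. \end{aligned}$$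
   Context: All vector spaces are finite-dimensional over $\mathbb C$; isomorphisms preserve the $\mathbb Z_2$-grading. A Leibniz superalgebra is a $\mathbb Z_2$-graded vector space $L=L_0\oplus L_1$ with an even (grading-compatible) bilinear product $[-,-]$ such that $[x,[y,z]]=[[x,y],z]-(-1)^{\alpha\beta}[[x,z],y]$ for all $x\in L$, $y\in L_\alpha$, $z\in L_\beta$. Nilpotency and solvability are defined as for Leibniz algebras, via $L^1=L,\ L^{k+1}=[L^k,L]$ and $L^{[1]}=L,\ L^{[k+1]}=[L^{[k]},L^{[k]}]$ respectively. The nilradical of $L$ is the maximal nilpotent ideal $N$ of $L$ such that $[L,L]\subset N$. $M(0,\dots,0)$ is the nilpotent Leibniz superalgebra with even basis $e_1,\dots,e_n$, odd basis $y_1,\dots,y_n$ and products (omitted products are zero) $$\begin{aligned} &[e_1,e_1]=e_3,\quad [e_i,e_1]=e_{i+1}\ (2\le i\le n-1),\quad [y_j,e_1]=y_{j+1}\ (1\le j\le n-1),\\ &[e_1,y_1]=\tfrac12y_2,\quad [e_i,y_1]=\tfrac12y_i\ (2\le i\le n),\quad [y_1,y_1]=e_1,\quad [y_j,y_1]=e_{j+1}\ (2\le j\le n-1). \end{aligned}$$ *)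

theory Defs
  imports Complex_Main "HOL-Library.Z2" "HOL-Library.Function_Algebras"
begin

text \<open>
  A superalgebra lives inside an ambient complex vector space, given by an abelian group
  \<^typ>\<open>'v\<close> and a scalar multiplication. Its homogeneous components are indexed by
  \<^typ>\<open>bit\<close>, the field with two elements, so that degrees add as in \<open>\<int>\<^sub>2\<close>.
  The values of the bracket outside the underlying space are irrelevant.
\<close>

record 'v superalgebra =
  scal :: "complex \<Rightarrow> 'v \<Rightarrow> 'v"
  part :: "bit \<Rightarrow> 'v set"
  br :: "'v \<Rightarrow> 'v \<Rightarrow> 'v"

definition space_of :: "'v::ab_group_add superalgebra \<Rightarrow> 'v set" where
  "space_of L = {u + v | u v. u \<in> part L 0 \<and> v \<in> part L 1}"

definition graded_space :: "'v::ab_group_add superalgebra \<Rightarrow> bool" where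
  "graded_space L \<longleftrightarrow>
     vector_space (scal L) \<and>
     (\<forall>a. module.subspace (scal L) (part L a)) \<and>
     part L 0 \<inter> part L 1 = {0}"

definition finite_dim :: "'v::ab_group_add superalgebra \<Rightarrow> bool" where
  "finite_dim L \<longleftrightarrow> (\<exists>B. finite B \<and> module.span (scal L) B = space_of L)"

definition bilinear_bracket :: "'v::ab_group_add superalgebra \<Rightarrow> bool" where
  "bilinear_bracket L \<longleftrightarrow>
     (\<forall>x\<in>space_of L. \<forall>y\<in>space_of L. \<forall>z\<in>space_of L.
        br L (x + y) z = br L x z + br L y z \<and> br L x (y + z) = br L x y + br L x z) \<and>
     (\<forall>x\<in>space_of L. \<forall>y\<in>space_of L. \<forall>c.
        br L (scal L c x) y = scal L c (br L x y) \<and> br L x (scal L c y) = scal L c (br L x y))"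

definition even_bracket :: "'v::ab_group_add superalgebra \<Rightarrow> bool" where
  "even_bracket L \<longleftrightarrow>
     (\<forall>a b. \<forall>x\<in>part L a. \<forall>y\<in>part L b. br L x y \<in> part L (a + b))"

definition koszul_sign :: "bit \<Rightarrow> bit \<Rightarrow> complex" where
  "koszul_sign a b = (if a * b = 1 then -1 else 1)"

definition leibniz_superalgebra :: "'v::ab_group_add superalgebra \<Rightarrow> bool" where
  "leibniz_superalgebra L \<longleftrightarrow>
     graded_space L \<and> bilinear_bracket L \<and> even_bracket L \<and>
     (\<forall>a b. \<forall>x\<in>space_of L. \<forall>y\<in>part L a. \<forall>z\<in>part L b.
        br L x (br L y z) =
          br L (br L x y) z - scal L (koszul_sign a b) (br L (br L x z) y))"

definition superalgebra_iso ::
  "'v::ab_group_add superalgebra \<Rightarrow> 'w::ab_group_add superalgebra \<Rightarrow> ('v \<Rightarrow> 'w) \<Rightarrow> bool" where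
  "superalgebra_iso L L' \<phi> \<longleftrightarrow>
     bij_betw \<phi> (space_of L) (space_of L') \<and>
     (\<forall>x\<in>space_of L. \<forall>y\<in>space_of L. \<phi> (x + y) = \<phi> x + \<phi> y) \<and>
     (\<forall>c. \<forall>x\<in>space_of L. \<phi> (scal L c x) = scal L' c (\<phi> x)) \<and>
     (\<forall>a. \<phi> ` part L a = part L' a) \<and>
     (\<forall>x\<in>space_of L. \<forall>y\<in>space_of L. \<phi> (br L x y) = br L' (\<phi> x) (\<phi> y))"

definition superalgebra_isomorphic ::
  "'v::ab_group_add superalgebra \<Rightarrow> 'w::ab_group_add superalgebra \<Rightarrow> bool" where
  "superalgebra_isomorphic L L' \<longleftrightarrow> (\<exists>\<phi>. superalgebra_iso L L' \<phi>)"

definition product_space :: "'v::ab_group_add superalgebra \<Rightarrow> 'v set \<Rightarrow> 'v set \<Rightarrow> 'v set" where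
  "product_space L A B = module.span (scal L) {br L x y | x y. x \<in> A \<and> y \<in> B}"

text \<open>
  Both series are indexed from \<open>0\<close>: \<open>lower_series L k\<close> is \<open>L\<^bsup>k+1\<^esup>\<close> and
  \<open>derived_series L k\<close> is \<open>L\<^bsup>[k+1]\<^esup>\<close>.
\<close>

primrec lower_series :: "'v::ab_group_add superalgebra \<Rightarrow> nat \<Rightarrow> 'v set" where
  "lower_series L 0 = space_of L"
| "lower_series L (Suc k) = product_space L (lower_series L k) (space_of L)"

primrec derived_series :: "'v::ab_group_add superalgebra \<Rightarrow> nat \<Rightarrow> 'v set" where
  "derived_series L 0 = space_of L"
| "derived_series L (Suc k) = product_space L (derived_series L k) (derived_series L k)"

definition super_nilpotent :: "'v::ab_group_add superalgebra \<Rightarrow> bool" where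
  "super_nilpotent L \<longleftrightarrow> (\<exists>k. lower_series L k = {0})"

definition super_solvable :: "'v::ab_group_add superalgebra \<Rightarrow> bool" where
  "super_solvable L \<longleftrightarrow> (\<exists>k. derived_series L k = {0})"

definition restrict_to :: "'v::ab_group_add superalgebra \<Rightarrow> 'v set \<Rightarrow> 'v superalgebra" where
  "restrict_to L N = L\<lparr>part := \<lambda>a. N \<inter> part L a\<rparr>"

text \<open>
  Ideals are two-sided and graded; the equation \<open>space_of (restrict_to L I) = I\<close> expresses
  that \<open>I\<close> is the sum of its homogeneous components.
\<close>

definition graded_ideal :: "'v::ab_group_add superalgebra \<Rightarrow> 'v set \<Rightarrow> bool" where
  "graded_ideal L I \<longleftrightarrow>
     module.subspace (scal L) I \<and> space_of (restrict_to L I) = I \<and>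
     (\<forall>x\<in>I. \<forall>y\<in>space_of L. br L x y \<in> I \<and> br L y x \<in> I)"

definition nilradical_candidate :: "'v::ab_group_add superalgebra \<Rightarrow> 'v set \<Rightarrow> bool" where
  "nilradical_candidate L N \<longleftrightarrow>
     graded_ideal L N \<and> super_nilpotent (restrict_to L N) \<and>
     product_space L (space_of L) (space_of L) \<subseteq> N"

definition is_nilradical :: "'v::ab_group_add superalgebra \<Rightarrow> 'v set \<Rightarrow> bool" where
  "is_nilradical L N \<longleftrightarrow>
     nilradical_candidate L N \<and>
     (\<forall>N'. nilradical_candidate L N' \<and> N \<subseteq> N' \<longrightarrow> N' = N)"

text \<open>
  The superalgebra with finite homogeneous basis \<open>B 0 \<union> B 1\<close> and structure constants \<open>T\<close>, as a
  space of coordinate functions: \<open>T i j\<close> is the coordinate vector of the product of the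
  basis elements \<open>i\<close> and \<open>j\<close>.
\<close>

definition table_superalgebra ::
  "(bit \<Rightarrow> 'i set) \<Rightarrow> ('i \<Rightarrow> 'i \<Rightarrow> 'i \<Rightarrow> complex) \<Rightarrow> ('i \<Rightarrow> complex) superalgebra" where
  "table_superalgebra B T =
     \<lparr>scal = (\<lambda>c f i. c * f i),
      part = (\<lambda>a. {f. \<forall>i. i \<notin> B a \<longrightarrow> f i = 0}),
      br = (\<lambda>f g k. \<Sum>i\<in>B 0 \<union> B 1. \<Sum>j\<in>B 0 \<union> B 1. f i * g j * T i j k)\<rparr>"

text \<open>\<open>coord c i\<close> is the coordinate vector of \<open>c\<close> times the basis element \<open>i\<close>.\<close>

definition coord :: "complex \<Rightarrow> 'i \<Rightarrow> 'i \<Rightarrow> complex" where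
  "coord c i = (\<lambda>j. if j = i then c else 0)"

text \<open>\<open>Eg i\<close>, \<open>Yg i\<close>, \<open>Xg\<close> stand for \<open>e\<^sub>i\<close>, \<open>y\<^sub>i\<close>, \<open>x\<close>; indices start at \<open>1\<close>.\<close>

datatype gen = Eg nat | Yg nat | Xg

fun M_table :: "nat \<Rightarrow> gen \<Rightarrow> gen \<Rightarrow> gen \<Rightarrow> complex" where
  "M_table n (Eg i) (Eg j) =
     (if i = 1 \<and> j = 1 then coord 1 (Eg 3)
      else if 2 \<le> i \<and> i \<le> n - 1 \<and> j = 1 then coord 1 (Eg (i + 1)) else 0)"
| "M_table n (Yg j) (Eg i) =
     (if 1 \<le> j \<and> j \<le> n - 1 \<and> i = 1 then coord 1 (Yg (j + 1)) else 0)"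
| "M_table n (Eg i) (Yg j) =
     (if i = 1 \<and> j = 1 then coord (1/2) (Yg 2)
      else if 2 \<le> i \<and> i \<le> n \<and> j = 1 then coord (1/2) (Yg i) else 0)"
| "M_table n (Yg j) (Yg i) =
     (if j = 1 \<and> i = 1 then coord 1 (Eg 1)
      else if 2 \<le> j \<and> j \<le> n - 1 \<and> i = 1 then coord 1 (Eg (j + 1)) else 0)"
| "M_table n _ _ = 0"

fun SM_table :: "nat \<Rightarrow> gen \<Rightarrow> gen \<Rightarrow> gen \<Rightarrow> complex" where
  "SM_table n (Eg i) Xg =
     (if i = 1 then coord 2 (Eg 1)
      else if 2 \<le> i \<and> i \<le> n then coord (2 * (of_nat i - 1)) (Eg i) else 0)"
| "SM_table n (Yg i) Xg =
     (if 1 \<le> i \<and> i \<le> n then coord (2 * of_nat i - 1) (Yg i) else 0)"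
| "SM_table n Xg (Eg i) = (if i = 1 then coord (-2) (Eg 1) else 0)"
| "SM_table n Xg (Yg i) = (if i = 1 then coord (-1) (Yg 1) else 0)"
| "SM_table n Xg Xg = 0"
| "SM_table n p q = M_table n p q"

text \<open>\<open>M_superalgebra n\<close> is \<open>M(0,\<dots>,0)\<close>.\<close>

definition M_superalgebra :: "nat \<Rightarrow> (gen \<Rightarrow> complex) superalgebra" where
  "M_superalgebra n =
     table_superalgebra (\<lambda>a. if a = 0 then Eg ` {1..n} else Yg ` {1..n}) (M_table n)"

definition SM_superalgebra :: "nat \<Rightarrow> (gen \<Rightarrow> complex) superalgebra" where
  "SM_superalgebra n =
     table_superalgebra (\<lambda>a. if a = 0 then insert Xg (Eg ` {1..n}) else Yg ` {1..n}) (SM_table n)"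

end

theory Submission
  imports Defs
begin

text \<open>
  Write \<open>N\<close> for the nilradical. The proof rests on a description of \<open>M(0,\<dots>,0)\<close> by two generators. Let \<open>y = y\<^sub>1\<close>
  and \<open>f = e\<^sub>2\<close>. Up to scalars, the powers \<open>v\<^sub>1 = y\<close>, \<open>v\<^bsub>k+1\<^esub> = [v\<^sub>k,y]\<close> for \<open>k < 2n\<close> are all the
  basis vectors except \<open>f\<close>, and the only other data are \<open>[f,y] = v\<^sub>3\<close> and \<open>[-,f] = 0\<close>. Everything else
  follows from the Leibniz identity, which gives
  \<open>[u,v\<^sub>2] = 2[[u,y],y]\<close> and \<open>[u,v\<^sub>k] = 0\<close> for \<open>k \<ge> 3\<close> and every \<open>u \<in> L\<close>. Give \<open>v\<^sub>k\<close> the weight \<open>k\<close> and \<open>f\<close>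
  the weight \<open>2\<close>.

  Right multiplication by a homogeneous \<open>z \<in> L\<close> is a superderivation of \<open>N\<close>. It preserves the filtration
  by weight and acts on the quotient of weight \<open>k\<close> as \<open>k \<kappa>(z)\<close> for one scalar \<open>\<kappa>(z)\<close>
  (\<open>weight_action\<close>), which is \<open>0\<close> for odd \<open>z\<close>. The kernel of \<open>\<kappa>\<close> is a nilpotent ideal containing the
  derived algebra, so it is \<open>N\<close> by maximality. Hence \<open>L = N \<oplus> \<complex>x\<close> with \<open>x\<close> even and \<open>\<kappa>(x) = 1\<close>
  (\<open>exists_toral_element\<close>).

  Since \<open>[-,x]\<close> acts on weight \<open>k\<close> as \<open>k\<close> modulo higher weights, eigenvectors can be lifted
  (\<open>eigen_lift\<close>), and \<open>y\<close> and \<open>f\<close> can be replaced by eigenvectors with eigenvalues \<open>1\<close> and \<open>2\<close> that satisfy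
  the same relations (\<open>diagonalize\<close>). All right products with \<open>x\<close> on \<open>N\<close> are then as in \<open>SM\<close>. By the same
  lifting \<open>x\<close> is corrected to have \<open>[x,x] = 0\<close>. The Leibniz identity together with the eigenvalues
  leaves no freedom for the left products:
  \<open>[x,f] = 0\<close> and \<open>[x,y] = -y\<close>, whence \<open>[x,v\<^sub>2] = -2v\<^sub>2\<close> (\<open>normalize_toral_element\<close>). It remains to scale the
  powers of \<open>y\<close> by powers of two and to compare tables (\<open>isomorphic_SM\<close>).
\<close>

section \<open>Calculus in a Leibniz superalgebra\<close>

locale leibniz_super =
  fixes L :: "'v::ab_group_add superalgebra"
  assumes leibniz: "leibniz_superalgebra L"
begin

abbreviation prod (infixl "\<bullet>" 70) where "x \<bullet> y \<equiv> br L x y"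
abbreviation smult (infixr "*\<^sub>L" 75) where "c *\<^sub>L x \<equiv> scal L c x"
abbreviation S where "S \<equiv> space_of L"

sublocale vector_space "scal L"
  using leibniz by (simp add: leibniz_superalgebra_def graded_space_def)

lemma subspace_part: "subspace (part L a)"
  and parts_disjoint: "part L 0 \<inter> part L 1 = {0}"
  using leibniz by (auto simp: leibniz_superalgebra_def graded_space_def)

lemma S_eq_span: "S = span (part L 0 \<union> part L 1)"
  by (simp add: space_of_def span_Un span_eq_iff[THEN iffD2, OF subspace_part])

lemma subspace_S: "subspace S"
  by (simp add: S_eq_span)

lemma part_S: "u \<in> part L a \<Longrightarrow> u \<in> S"
  by (cases a) (auto simp: S_eq_span intro: span_base)

lemma S_decompose:
  assumes "u \<in> S" obtains u0 u1 where "u = u0 + u1" "u0 \<in> part L 0" "u1 \<in> part L 1"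
  using assms unfolding space_of_def by blast

lemma part_zero [simp]: "0 \<in> part L a"
  and part_add: "u \<in> part L a \<Longrightarrow> w \<in> part L a \<Longrightarrow> u + w \<in> part L a"
  and part_diff: "u \<in> part L a \<Longrightarrow> w \<in> part L a \<Longrightarrow> u - w \<in> part L a"
  and part_scale: "u \<in> part L a \<Longrightarrow> c *\<^sub>L u \<in> part L a"
  using subspace_part subspace_0 subspace_add subspace_diff subspace_scale by auto

lemma S_zero [simp]: "0 \<in> S"
  and S_add [simp]: "u \<in> S \<Longrightarrow> w \<in> S \<Longrightarrow> u + w \<in> S"
  and S_diff [simp]: "u \<in> S \<Longrightarrow> w \<in> S \<Longrightarrow> u - w \<in> S"
  and S_scale [simp]: "u \<in> S \<Longrightarrow> c *\<^sub>L u \<in> S"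
  and S_neg [simp]: "u \<in> S \<Longrightarrow> - u \<in> S"
  using subspace_S subspace_0 subspace_add subspace_diff subspace_scale subspace_neg by auto

lemma parts_meet: "u \<in> part L a \<Longrightarrow> u \<in> part L b \<Longrightarrow> a \<noteq> b \<Longrightarrow> u = 0"
  using parts_disjoint by (cases a; cases b) auto

lemma br_part: "u \<in> part L a \<Longrightarrow> w \<in> part L b \<Longrightarrow> u \<bullet> w \<in> part L (a + b)"
  using leibniz by (auto simp: leibniz_superalgebra_def even_bracket_def)

lemma br_add_left [simp]: "u \<in> S \<Longrightarrow> w \<in> S \<Longrightarrow> z \<in> S \<Longrightarrow> (u + w) \<bullet> z = u \<bullet> z + w \<bullet> z"
  and br_add_right [simp]: "u \<in> S \<Longrightarrow> w \<in> S \<Longrightarrow> z \<in> S \<Longrightarrow> z \<bullet> (u + w) = z \<bullet> u + z \<bullet> w"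
  and br_scale_left [simp]: "u \<in> S \<Longrightarrow> z \<in> S \<Longrightarrow> (c *\<^sub>L u) \<bullet> z = c *\<^sub>L (u \<bullet> z)"
  and br_scale_right [simp]: "u \<in> S \<Longrightarrow> z \<in> S \<Longrightarrow> z \<bullet> (c *\<^sub>L u) = c *\<^sub>L (z \<bullet> u)"
  using leibniz by (auto simp: leibniz_superalgebra_def bilinear_bracket_def)

lemma br_zero_left [simp]: "z \<in> S \<Longrightarrow> 0 \<bullet> z = 0"
  using br_scale_left[of 0 z 0] by simp

lemma br_zero_right [simp]: "z \<in> S \<Longrightarrow> z \<bullet> 0 = 0"
  using br_scale_right[of 0 z 0] by simp

lemma br_diff_left [simp]: "u \<in> S \<Longrightarrow> w \<in> S \<Longrightarrow> z \<in> S \<Longrightarrow> (u - w) \<bullet> z = u \<bullet> z - w \<bullet> z"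
  using br_add_left[of "u - w" w z] by simp

lemma br_diff_right [simp]: "u \<in> S \<Longrightarrow> w \<in> S \<Longrightarrow> z \<in> S \<Longrightarrow> z \<bullet> (u - w) = z \<bullet> u - z \<bullet> w"
  using br_add_right[of "u - w" w z] by simp

lemma br_neg_left [simp]: "u \<in> S \<Longrightarrow> z \<in> S \<Longrightarrow> (- u) \<bullet> z = - (u \<bullet> z)"
  using br_diff_left[of 0 u z] by simp

lemma br_S [simp]: assumes "u \<in> S" "w \<in> S" shows "u \<bullet> w \<in> S"
proof -
  from S_decompose[OF assms(1)] obtain u0 u1
    where u: "u = u0 + u1" "u0 \<in> part L 0" "u1 \<in> part L 1" .
  from S_decompose[OF assms(2)] obtain w0 w1
    where w: "w = w0 + w1" "w0 \<in> part L 0" "w1 \<in> part L 1" .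
  show ?thesis
    using u w by (simp add: part_S br_part[THEN part_S])
qed

lemma leibniz_identity:
  assumes "u \<in> S" "w \<in> part L a" "z \<in> part L b"
  shows "u \<bullet> (w \<bullet> z) = (u \<bullet> w) \<bullet> z - koszul_sign a b *\<^sub>L ((u \<bullet> z) \<bullet> w)"
  using leibniz assms by (auto simp: leibniz_superalgebra_def)

lemma leibniz_even:
  assumes "u \<in> S" "w \<in> part L a" "z \<in> part L b" "a = 0 \<or> b = 0"
  shows "u \<bullet> (w \<bullet> z) = (u \<bullet> w) \<bullet> z - (u \<bullet> z) \<bullet> w"
  using leibniz_identity[OF assms(1-3)] assms(4) by (auto simp: koszul_sign_def)

lemma leibniz_odd:
  assumes "u \<in> S" "w \<in> part L 1" "z \<in> part L 1"
  shows "u \<bullet> (w \<bullet> z) = (u \<bullet> w) \<bullet> z + (u \<bullet> z) \<bullet> w"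
  using leibniz_identity[OF assms] by (simp add: koszul_sign_def)

lemma br_span_left:
  assumes "u \<in> span H" "\<And>h. h \<in> H \<Longrightarrow> h \<bullet> z \<in> T" "subspace T" "H \<subseteq> S" "z \<in> S"
  shows "u \<bullet> z \<in> T"
proof -
  have "u \<in> S \<and> u \<bullet> z \<in> T"
    using assms(1)
  proof (induction rule: span_induct_alt)
    case base
    then show ?case using assms(3,5) by (simp add: subspace_0)
  next
    case (step c h w)
    then show ?case using assms
      by (auto simp: subset_iff intro!: subspace_add subspace_scale)
  qed
  then show ?thesis ..
qed

lemma br_span_right:
  assumes "u \<in> span H" "\<And>h. h \<in> H \<Longrightarrow> z \<bullet> h \<in> T" "subspace T" "H \<subseteq> S" "z \<in> S"
  shows "z \<bullet> u \<in> T"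
proof -
  have "u \<in> S \<and> z \<bullet> u \<in> T"
    using assms(1)
  proof (induction rule: span_induct_alt)
    case base
    then show ?case using assms(3,5) by (simp add: subspace_0)
  next
    case (step c h w)
    then show ?case using assms
      by (auto simp: subset_iff intro!: subspace_add subspace_scale)
  qed
  then show ?thesis ..
qed

lemma span_homogeneous_part:
  assumes "u \<in> span H" "H \<subseteq> part L 0 \<union> part L 1" "u \<in> part L a"
  shows "u \<in> span (H \<inter> part L a)"
proof -
  have "H = (H \<inter> part L a) \<union> (H \<inter> part L (a + 1))"
    using assms(2) by (cases a) auto
  then have "u \<in> span ((H \<inter> part L a) \<union> (H \<inter> part L (a + 1)))"
    using assms(1) by simp
  then obtain p q where pq: "u = p + q" "p \<in> span (H \<inter> part L a)" "q \<in> span (H \<inter> part L (a + 1))"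
    unfolding span_Un by blast
  have sub: "span (H \<inter> part L b) \<subseteq> part L b" for b
    by (intro span_minimal subspace_part) auto
  have "q = u - p" using pq by simp
  then have "q \<in> part L a" using pq assms(3) sub part_diff by blast
  moreover have "q \<in> part L (a + 1)" using pq sub by blast
  ultimately have "q = 0" using parts_meet[of q a "a + 1"] by (cases a) auto
  then show ?thesis using pq by simp
qed

end

section \<open>The weight filtration of a filiform radical\<close>

context leibniz_super
begin

text \<open>
  Left-normed powers \<open>[\<dots>[[y,y],y],\<dots>,y]\<close>, with \<open>rpow y 0 = y\<close> as a dummy value.
\<close>

definition rpow :: "'v \<Rightarrow> nat \<Rightarrow> 'v" where
  "rpow y k = ((\<lambda>u. u \<bullet> y) ^^ (k - 1)) y"

lemma rpow_1 [simp]: "rpow y 1 = y" "rpow y (Suc 0) = y"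
  by (simp_all add: rpow_def)

lemma rpow_Suc: "k \<ge> 1 \<Longrightarrow> rpow y (Suc k) = rpow y k \<bullet> y"
  by (cases k) (simp_all add: rpow_def)

lemma rpow_part:
  assumes "y \<in> part L 1" "k \<ge> 1"
  shows "rpow y k \<in> part L (of_nat k)"
  using assms(2)
proof (induction k rule: dec_induct)
  case base
  then show ?case using assms(1) by simp
next
  case (step k)
  then show ?case using br_part[OF step.IH assms(1)] by (simp add: rpow_Suc add.commute)
qed

text \<open>
  Generators of the filtration by weight, in which \<open>rpow y k\<close> has weight \<open>k\<close> and \<open>f\<close> has weight \<open>2\<close>.
\<close>

definition flag_gens :: "'v \<Rightarrow> 'v \<Rightarrow> nat \<Rightarrow> 'v set" where
  "flag_gens y f k = rpow y ` {k..} \<union> (if k \<le> 2 then {f} else {})"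

lemma flag_gens_step: "k \<noteq> 2 \<Longrightarrow> flag_gens y f k = insert (rpow y k) (flag_gens y f (Suc k))"
proof -
  have "{k..} = insert k {Suc k..}" by auto
  then show "k \<noteq> 2 \<Longrightarrow> ?thesis" by (auto simp: flag_gens_def)
qed

lemma flag_gens_2: "flag_gens y f 2 = insert f (insert (rpow y 2) (flag_gens y f 3))"
proof -
  have "{2::nat..} = insert 2 {3..}" by auto
  then show ?thesis by (auto simp: flag_gens_def)
qed

definition flag :: "'v \<Rightarrow> 'v \<Rightarrow> nat \<Rightarrow> 'v set" where
  "flag y f k = span (flag_gens y f k)"

lemma flag_diff: "u \<in> flag y f k \<Longrightarrow> w \<in> flag y f k \<Longrightarrow> u - w \<in> flag y f k"
  unfolding flag_def by (rule span_diff)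

lemma flag_mono: "k \<le> l \<Longrightarrow> flag y f l \<subseteq> flag y f k"
  unfolding flag_def by (rule span_mono) (auto simp: flag_gens_def)

lemma rpow_flag: "k \<le> j \<Longrightarrow> rpow y j \<in> flag y f k"
  unfolding flag_def by (auto simp: flag_gens_def intro!: span_base)

lemma generator_flag: "k \<le> 2 \<Longrightarrow> f \<in> flag y f k"
  unfolding flag_def by (auto simp: flag_gens_def intro!: span_base)

end

text \<open>
  The superalgebra \<open>M(0,\<dots>,0)\<close> has an economical presentation, and the locale describes a
  superalgebra whose derived algebra lies in a copy of it. It is spanned by the powers \<open>v\<^sub>k\<close> of the
  odd element \<open>y = y\<^sub>1\<close> and by \<open>f = e\<^sub>2\<close>. Indeed \<open>v\<^sub>2 = e\<^sub>1\<close>, the vector \<open>v\<^bsub>2i-1\<^esub>\<close> is a multiple of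
  \<open>y\<^sub>i\<close>, and \<open>v\<^bsub>2i\<^esub>\<close> is a multiple of \<open>e\<^bsub>i+1\<^esub>\<close> for \<open>i \<ge> 2\<close>. Right multiplication by \<open>y\<close> shifts the chain of
  powers and sends \<open>f\<close> into it. By the Leibniz identity, right multiplication by \<open>v\<^sub>2\<close> is twice the
  square of right multiplication by \<open>y\<close>, and right multiplication by \<open>v\<^sub>k\<close> vanishes for \<open>k \<ge> 3\<close>.
  The table of \<open>M(0,\<dots>,0)\<close> is thus determined by the
  last nonzero power, \<open>m = 2n-1\<close>, and by \<open>[f,y] = v\<^sub>3\<close> and \<open>[-,f] = 0\<close>.
\<close>

locale filiform_radical = leibniz_super L for L :: "'v::ab_group_add superalgebra" +
  fixes y f :: 'v and m :: nat
  assumes y_odd: "y \<in> part L 1"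
    and f_even: "f \<in> part L 0"
    and m_ge_3: "m \<ge> 3"
    and f_y: "f \<bullet> y = rpow y 3"
    and radical_f: "u \<in> flag y f 1 \<Longrightarrow> u \<bullet> f = 0"
    and rpow_m: "rpow y m \<noteq> 0"
    and rpow_Suc_m: "rpow y (Suc m) = 0"
    and derived: "u \<in> space_of L \<Longrightarrow> w \<in> space_of L \<Longrightarrow> u \<bullet> w \<in> flag y f 1"
begin

abbreviation v where "v \<equiv> rpow y"
abbreviation G where "G \<equiv> flag y f"

lemma y_S [simp]: "y \<in> S" and f_S [simp]: "f \<in> S"
  using y_odd f_even part_S by auto

lemma v_S [simp]: "v k \<in> S"
  using rpow_part[OF y_odd, of k, THEN part_S] by (cases "k = 0") (auto simp: rpow_def)

lemma v_part: "k \<ge> 1 \<Longrightarrow> v k \<in> part L (of_nat k)"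
  by (rule rpow_part[OF y_odd])

lemma v_Suc: "k \<ge> 1 \<Longrightarrow> v k \<bullet> y = v (Suc k)"
  by (simp add: rpow_Suc)

lemma y_y: "y \<bullet> y = v 2"
  and v2_y: "v 2 \<bullet> y = v 3"
  using v_Suc[of 1] v_Suc[of 2] by (simp_all add: eval_nat_numeral)

lemma subspace_G: "subspace (G k)"
  by (simp add: flag_def)

lemma G_zero [simp]: "0 \<in> G k"
  and G_add: "u \<in> G k \<Longrightarrow> w \<in> G k \<Longrightarrow> u + w \<in> G k"
  and G_diff: "u \<in> G k \<Longrightarrow> w \<in> G k \<Longrightarrow> u - w \<in> G k"
  and G_scale: "u \<in> G k \<Longrightarrow> c *\<^sub>L u \<in> G k"
  and G_neg: "u \<in> G k \<Longrightarrow> - u \<in> G k"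
  by (auto simp: flag_def intro: span_zero span_add span_diff span_scale span_neg)

lemma gens_S: "flag_gens y f k \<subseteq> S"
  by (auto simp: flag_gens_def)

lemma G_S: "u \<in> G k \<Longrightarrow> u \<in> S"
  unfolding flag_def using span_minimal[OF gens_S subspace_S] by blast

lemma G_mono: "k \<le> l \<Longrightarrow> u \<in> G l \<Longrightarrow> u \<in> G k"
  using flag_mono by blast

lemmas v_G = rpow_flag[of _ _ y f]

lemmas f_G = generator_flag[of _ f y]

lemma y_G1: "y \<in> G 1"
  using v_G[of 1 1] by simp

lemma G_split:
  assumes "u \<in> G k" "k \<noteq> 2"
  obtains c where "u - c *\<^sub>L v k \<in> G (Suc k)"
  using assms by (auto simp: flag_def flag_gens_step span_insert)

lemma G1_split:
  assumes "u \<in> G 1"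
  obtains c where "u - c *\<^sub>L y \<in> G 2"
  using G_split[OF assms] that by (auto simp: numeral_2_eq_2)

lemma G2_split:
  assumes "u \<in> G 2"
  obtains a b where "u - a *\<^sub>L f - b *\<^sub>L v 2 \<in> G 3"
  using assms by (auto simp: flag_def flag_gens_2 span_insert)

lemma v_beyond: "k > m \<Longrightarrow> v k = 0"
proof (induction k rule: less_induct)
  case (less k)
  show ?case
  proof (cases "k = Suc m")
    case False
    then have "v k = v (k - 1) \<bullet> y" "v (k - 1) = 0"
      using less v_Suc[of "k - 1"] m_ge_3 by auto
    then show ?thesis by simp
  qed (simp add: rpow_Suc_m)
qed

lemma G_beyond: "k > m \<Longrightarrow> G k = {0}"
proof -
  assume "k > m"
  then have "flag_gens y f k = {0}"
    using m_ge_3 v_beyond by (auto simp: flag_gens_def)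
  then show ?thesis by (simp add: flag_def span_eq_iff[THEN iffD2])
qed

lemma br_v2: "u \<in> S \<Longrightarrow> u \<bullet> v 2 = 2 *\<^sub>L ((u \<bullet> y) \<bullet> y)"
  using leibniz_odd[of u y y] y_odd v_Suc[of 1] scale_left_distrib[of 1 1 "(u \<bullet> y) \<bullet> y"]
  by (simp add: numeral_2_eq_2)

text \<open>
  In an expansion of \<open>[u,[v\<^sub>2,y]]\<close> the two terms are both \<open>2[[[u,y],y],y]\<close> and cancel; from then on the
  kernel of right multiplication propagates along the chain of powers. This holds for every \<open>u\<close>, also
  outside the radical, and settles most left products with a complement of the radical.
\<close>

lemma br_v_ge3: "k \<ge> 3 \<Longrightarrow> u \<in> S \<Longrightarrow> u \<bullet> v k = 0"
proof (induction k arbitrary: u rule: dec_induct)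
  case base
  have "v 2 \<in> part L 0" using v_part[of 2] by simp
  then have "u \<bullet> (v 2 \<bullet> y) = (u \<bullet> v 2) \<bullet> y - (u \<bullet> y) \<bullet> v 2"
    using base y_odd leibniz_even by blast
  also have "\<dots> = 0" using base by (simp add: br_v2)
  finally show ?case using v_Suc[of 2] by (simp add: eval_nat_numeral)
next
  case (step k)
  have "u \<bullet> (v k \<bullet> y) = 0"
    using leibniz_identity[OF step.prems v_part[of k] y_odd] step by simp
  then show ?case using step v_Suc[of k] by simp
qed

lemma br_G3: "w \<in> G 3 \<Longrightarrow> u \<in> S \<Longrightarrow> u \<bullet> w = 0"
  using br_span_right[of w "flag_gens y f 3" u "{0}"] gens_S[of 3] br_v_ge3
  by (force simp: flag_def flag_gens_def)

lemma G_y: "u \<in> G k \<Longrightarrow> k \<ge> 1 \<Longrightarrow> u \<bullet> y \<in> G (Suc k)"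
  unfolding flag_def[of y f k]
  by (erule br_span_left[OF _ _ subspace_G gens_S])
    (auto simp: flag_gens_def v_Suc f_y intro!: v_G split: if_splits)

lemma G_G2:
  assumes "u \<in> G k" "k \<ge> 1" "w \<in> G 2"
  shows "u \<bullet> w \<in> G (k + 2)"
  using assms(3) unfolding flag_def[of y f 2]
proof (rule br_span_right[OF _ _ subspace_G gens_S])
  fix h assume "h \<in> flag_gens y f 2"
  then consider "h = f" | "h = v 2" | "h \<in> G 3"
    by (auto simp: flag_gens_2 flag_def intro: span_base)
  then show "u \<bullet> h \<in> G (k + 2)"
  proof cases
    case 1
    then show ?thesis using radical_f G_mono[of 1 k u] assms by simp
  next
    case 2
    have "(u \<bullet> y) \<bullet> y \<in> G (Suc (Suc k))" using assms G_y by simp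
    then show ?thesis using 2 assms G_S by (simp add: br_v2 G_scale)
  next
    case 3
    then show ?thesis using assms G_S by (simp add: br_G3)
  qed
qed (use assms G_S in auto)

text \<open>
  Multiplying on the right by \<open>y\<close> would push a relation between \<open>v\<^sub>k\<close> and higher weights up to
  \<open>v\<^sub>m = 0\<close>. So the single condition \<open>v\<^sub>m \<noteq> 0\<close> makes the powers independent, and the
  same holds for any other pair of generators that satisfies the relations.
\<close>

lemma v_strict:
  assumes "c *\<^sub>L v k \<in> G (Suc k)" "1 \<le> k" "k \<le> m"
  shows "c = 0"
proof (rule ccontr)
  assume "c \<noteq> 0"
  then have *: "v k \<in> G (Suc k)" using G_scale[OF assms(1), of "inverse c"] by simp
  have "v (k + i) \<in> G (Suc (k + i))" for i
  proof (induction i)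
    case (Suc i)
    then show ?case using G_y[OF Suc.IH] v_Suc[of "k + i"] assms by simp
  qed (use * in simp)
  from this[of "m - k"] show False using assms G_beyond[of "Suc m"] rpow_m by simp
qed

lemma v_nonzero: "1 \<le> k \<Longrightarrow> k \<le> m \<Longrightarrow> v k \<noteq> 0"
  using v_strict[of 1 k] by auto

text \<open>
  Weight \<open>2\<close> is the only weight with two generators, \<open>f\<close> and \<open>v\<^sub>2\<close>. Left multiplication by \<open>y\<close> kills
  \<open>f\<close> and not \<open>v\<^sub>2\<close>, which separates them.
\<close>

lemma degree_two_strict:
  assumes "a *\<^sub>L f + b *\<^sub>L v 2 \<in> G 3"
  shows "a = 0" "b = 0"
proof -
  have "y \<bullet> (a *\<^sub>L f + b *\<^sub>L v 2) = 0" using assms br_G3 by simp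
  then have "(2 * b) *\<^sub>L v 3 = 0"
    using radical_f[OF y_G1] by (simp add: br_v2 y_y v2_y ac_simps)
  then show b: "b = 0" using v_nonzero[of 3] m_ge_3 by simp
  then have "(a *\<^sub>L f) \<bullet> y \<in> G (Suc 3)" using G_y[OF assms] by simp
  then show "a = 0" using v_strict[of a 3] m_ge_3 by (simp add: f_y)
qed

lemma gens_homogeneous:
  assumes "k \<ge> 1" shows "flag_gens y f k \<subseteq> part L 0 \<union> part L 1"
proof -
  have "v j \<in> part L 0 \<union> part L 1" if "j \<ge> 1" for j
    using v_part[OF that] by (cases "of_nat j :: bit") auto
  then show ?thesis
    unfolding flag_gens_def using f_even assms by (intro Un_least image_subsetI) simp_all
qed

lemma even_G2:
  assumes "u \<in> G 1" "u \<in> part L 0" shows "u \<in> G 2"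
proof -
  have "u \<in> span (flag_gens y f 1 \<inter> part L 0)"
    using assms span_homogeneous_part gens_homogeneous unfolding flag_def by blast
  moreover have "flag_gens y f 1 \<inter> part L 0 \<subseteq> G 2"
  proof
    fix h assume h: "h \<in> flag_gens y f 1 \<inter> part L 0"
    have "v 1 \<notin> part L 0" using parts_meet[of y 0 1] y_odd v_nonzero[of 1] m_ge_3 by auto
    then have "h \<in> flag_gens y f 2"
      using h flag_gens_step[of 1] by (auto simp: numeral_2_eq_2)
    then show "h \<in> G 2" by (simp add: flag_def span_base)
  qed
  ultimately show ?thesis using span_minimal[OF _ subspace_G] by blast
qed

lemma odd_G3:
  assumes "u \<in> G 2" "u \<in> part L 1" shows "u \<in> G 3"
proof -
  have "u \<in> span (flag_gens y f 2 \<inter> part L 1)"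
    using assms span_homogeneous_part gens_homogeneous[of 2] unfolding flag_def by simp
  moreover have "flag_gens y f 2 \<inter> part L 1 \<subseteq> G 3"
  proof
    fix h assume h: "h \<in> flag_gens y f 2 \<inter> part L 1"
    have "v 2 \<notin> part L 1" using parts_meet[of "v 2" 0 1] v_part[of 2] v_nonzero[of 2] m_ge_3 by auto
    moreover have "f \<in> part L 1 \<Longrightarrow> f = 0" using parts_meet[of f 0 1] f_even by auto
    ultimately have "h = 0 \<or> h \<in> flag_gens y f 3"
      using h by (auto simp: flag_gens_2)
    then show "h \<in> G 3" by (auto simp: flag_def span_base span_zero)
  qed
  ultimately show ?thesis using span_minimal[OF _ subspace_G] by blast
qed

lemma br_G1 [intro]: "u \<in> S \<Longrightarrow> w \<in> S \<Longrightarrow> u \<bullet> w \<in> G 1"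
  by (rule derived)

text \<open>
  Right multiplication by \<open>z\<close> is a superderivation, so its leading eigenvalue on \<open>v\<^sub>k = [v\<^bsub>k-1\<^esub>,y]\<close> is \<open>k\<close>
  times the one on \<open>y\<close>. For odd \<open>z\<close> the leading eigenvalue is \<open>0\<close> by parity, and the Koszul sign in
  the derivation rule then does no harm.
\<close>

lemma weight_action_v:
  assumes z: "z \<in> part L a" "y \<bullet> z - \<kappa> *\<^sub>L y \<in> G 2" and "\<kappa> \<noteq> 0 \<Longrightarrow> a = 0" and "k \<ge> 1"
  shows "v k \<bullet> z - (of_nat k * \<kappa>) *\<^sub>L v k \<in> G (Suc k)"
  using assms(4)
proof (induction k rule: dec_induct)
  case base
  then show ?case using z by (simp add: numeral_2_eq_2)
next
  case (step k)
  define s where "s = koszul_sign 1 a"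
  have s: "s * \<kappa> = \<kappa>" using assms(3) by (auto simp: s_def koszul_sign_def)
  define g where "g = y \<bullet> z - \<kappa> *\<^sub>L y"
  define r where "r = v k \<bullet> z - (of_nat k * \<kappa>) *\<^sub>L v k"
  have zS: "z \<in> S" using z part_S by blast
  have g: "g \<in> G 2" "g \<in> S" "y \<bullet> z = \<kappa> *\<^sub>L y + g"
    using z zS by (simp_all add: g_def)
  have r: "r \<in> G (Suc k)" "r \<in> S" "v k \<bullet> z = (of_nat k * \<kappa>) *\<^sub>L v k + r"
    using step.IH zS by (simp_all add: r_def)
  have "(v k \<bullet> y) \<bullet> z = v k \<bullet> (y \<bullet> z) + s *\<^sub>L ((v k \<bullet> z) \<bullet> y)"
    using leibniz_identity[OF v_S y_odd z(1)] by (simp add: s_def)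
  also have "\<dots> = (\<kappa> + s * (of_nat k * \<kappa>)) *\<^sub>L v (Suc k) + (v k \<bullet> g + s *\<^sub>L (r \<bullet> y))"
    using g(2) r(2) step(1) by (simp add: g(3) r(3) v_Suc scale_right_distrib scale_left_distrib)
  also have "\<kappa> + s * (of_nat k * \<kappa>) = of_nat (Suc k) * \<kappa>"
    using arg_cong[OF s, of "\<lambda>t. of_nat k * t"] by (simp add: algebra_simps)
  finally have "v (Suc k) \<bullet> z - (of_nat (Suc k) * \<kappa>) *\<^sub>L v (Suc k) = v k \<bullet> g + s *\<^sub>L (r \<bullet> y)"
    using step(1) by (simp add: v_Suc)
  moreover have "v k \<bullet> g \<in> G (Suc (Suc k))"
    using G_G2[OF v_G[of k k] step(1) g(1)] by simp
  moreover have "r \<bullet> y \<in> G (Suc (Suc k))"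
    using G_y[OF r(1)] by simp
  ultimately show ?case by (simp add: G_add G_scale)
qed

text \<open>
  The products \<open>[y,f] = 0\<close> and \<open>[f,y] = v\<^sub>3\<close> must be respected by the derivation. The first excludes
  the components of \<open>[f,z]\<close> along \<open>y\<close> and \<open>v\<^sub>2\<close>; the second compares the coefficient of \<open>f\<close>
  with the eigenvalue \<open>3\<kappa>\<close> on \<open>v\<^sub>3\<close>, of which \<open>\<kappa>\<close> is already contributed by \<open>y\<close>.
\<close>

lemma weight_action_f:
  assumes z: "z \<in> part L a" "y \<bullet> z - \<kappa> *\<^sub>L y \<in> G 2" and "\<kappa> \<noteq> 0 \<Longrightarrow> a = 0"
  shows "f \<bullet> z - (2 * \<kappa>) *\<^sub>L f \<in> G 3"
proof -
  define s where "s = koszul_sign 1 a"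
  have s: "s * s = 1" "s * \<kappa> = \<kappa>" using assms(3) by (auto simp: s_def koszul_sign_def)
  have zS [simp]: "z \<in> S" using z part_S by blast
  define g where "g = y \<bullet> z - \<kappa> *\<^sub>L y"
  have g: "g \<in> G 2" "g \<in> S" "y \<bullet> z = \<kappa> *\<^sub>L y + g"
    using z by (simp_all add: g_def)
  define u where "u = f \<bullet> z"
  have u: "u \<in> G 1" "u \<in> S" using derived[of f z] by (simp_all add: u_def)
  obtain b where b: "u - b *\<^sub>L y \<in> G 2"
    using G1_split[OF u(1)] .
  obtain \<beta> \<mu> where h: "u - b *\<^sub>L y - \<beta> *\<^sub>L f - \<mu> *\<^sub>L v 2 \<in> G 3" (is "?h \<in> _")
    using G2_split[OF b] .
  have "y \<bullet> (f \<bullet> z) = (y \<bullet> f) \<bullet> z - (y \<bullet> z) \<bullet> f"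
    using leibniz_even[OF y_S f_even z(1)] by simp
  also have "\<dots> = 0" using radical_f[OF y_G1] radical_f[OF derived[OF y_S zS]] by simp
  finally have "y \<bullet> u = 0" by (simp add: u_def)
  moreover have "y \<bullet> ?h = 0" using br_G3[OF h y_S] .
  ultimately have "- (b *\<^sub>L v 2) = (2 * \<mu>) *\<^sub>L v 3"
    using u(2) radical_f[OF y_G1] by (simp add: br_v2 y_y v2_y ac_simps)
  then have 0: "b *\<^sub>L v 2 + (2 * \<mu>) *\<^sub>L v 3 = 0" by (simp only: neg_eq_iff_add_eq_0)
  then have "b *\<^sub>L v 2 = - ((2 * \<mu>) *\<^sub>L v 3)" by (simp add: eq_neg_iff_add_eq_0)
  then have "b *\<^sub>L v 2 \<in> G (Suc 2)" by (auto intro: G_neg G_scale v_G)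
  then have b0: "b = 0" using v_strict[of b 2] m_ge_3 by simp
  with 0 have \<mu>0: "\<mu> = 0" using v_nonzero[of 3] m_ge_3 by simp
  define h' where "h' = u - \<beta> *\<^sub>L f"
  have h': "h' \<in> G 3" "h' \<in> S" "u = \<beta> *\<^sub>L f + h'" using h u(2) b0 \<mu>0 by (simp_all add: h'_def)
  have "(f \<bullet> y) \<bullet> z = f \<bullet> (y \<bullet> z) + s *\<^sub>L ((f \<bullet> z) \<bullet> y)"
    using leibniz_identity[OF f_S y_odd z(1)] by (simp add: s_def)
  also have "\<dots> = \<kappa> *\<^sub>L v 3 + f \<bullet> g + (s * \<beta>) *\<^sub>L v 3 + s *\<^sub>L (h' \<bullet> y)"
    using g(2) h'(2) by (simp add: g(3) h'(3) f_y scale_right_distrib flip: u_def)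
  finally have "v 3 \<bullet> z = \<kappa> *\<^sub>L v 3 + f \<bullet> g + (s * \<beta>) *\<^sub>L v 3 + s *\<^sub>L (h' \<bullet> y)"
    by (simp add: f_y)
  moreover have "(of_nat 3 * \<kappa>) *\<^sub>L v 3 = \<kappa> *\<^sub>L v 3 + (2 * \<kappa>) *\<^sub>L v 3"
    by (simp flip: scale_left_distrib)
  ultimately have "(2 * \<kappa> - s * \<beta>) *\<^sub>L v 3 =
      f \<bullet> g + s *\<^sub>L (h' \<bullet> y) - (v 3 \<bullet> z - (of_nat 3 * \<kappa>) *\<^sub>L v 3)"
    by (simp add: algebra_simps)
  moreover have "f \<bullet> g \<in> G 4" using G_G2[OF f_G[of 2] _ g(1)] by simp
  moreover have "h' \<bullet> y \<in> G 4" using G_y[OF h'(1)] by simp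
  moreover have "v 3 \<bullet> z - (of_nat 3 * \<kappa>) *\<^sub>L v 3 \<in> G 4"
    using weight_action_v[OF assms, of 3] by simp
  ultimately have "(2 * \<kappa> - s * \<beta>) *\<^sub>L v 3 \<in> G (Suc 3)" by (simp add: G_add G_diff G_scale)
  then have "2 * \<kappa> - s * \<beta> = 0" by (rule v_strict) (use m_ge_3 in simp_all)
  then have "s * \<beta> = 2 * \<kappa>" by simp
  \<comment> \<open>the sign \<open>s\<close> can differ from \<open>1\<close> only if \<open>\<kappa> = 0\<close>\<close>
  then have "s * (s * \<beta>) = 2 * (s * \<kappa>)" by simp
  then have "\<beta> = 2 * \<kappa>" using s by (simp flip: mult.assoc)
  then show ?thesis using h' by (simp add: u_def)
qed

text \<open>
  A generator whose weight exceeds \<open>k\<close> contributes only to higher weights, whatever its own eigenvalue, so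
  the two computations on generators extend to their span. The number \<open>\<kappa>\<close> is the only trace that \<open>z\<close>
  leaves on the graded quotients.
\<close>

lemma weight_action:
  assumes z: "z \<in> part L a" "y \<bullet> z - \<kappa> *\<^sub>L y \<in> G 2" "\<kappa> \<noteq> 0 \<Longrightarrow> a = 0"
    and "u \<in> G k" "k \<ge> 1"
  shows "u \<bullet> z - (of_nat k * \<kappa>) *\<^sub>L u \<in> G (Suc k)"
proof -
  have zS [simp]: "z \<in> S" using z part_S by blast
  have gen: "h \<in> S \<and> h \<bullet> z - (of_nat k * \<kappa>) *\<^sub>L h \<in> G (Suc k)" if h: "h \<in> flag_gens y f k" for h
  proof -
    consider j where "j \<ge> k" "h = v j" | "k \<le> 2" "h = f"
      using h by (auto simp: flag_gens_def split: if_splits)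
    then show ?thesis
    proof cases
      case 1
      have "v j \<bullet> z - (of_nat j * \<kappa>) *\<^sub>L v j \<in> G (Suc k)"
        using weight_action_v[OF z, of j] G_mono[of "Suc k" "Suc j"] 1 assms(5) by simp
      moreover have "((of_nat j - of_nat k) * \<kappa>) *\<^sub>L v j \<in> G (Suc k)"
        using 1 by (cases "j = k") (simp_all add: G_scale v_G)
      ultimately have "(v j \<bullet> z - (of_nat j * \<kappa>) *\<^sub>L v j) + ((of_nat j - of_nat k) * \<kappa>) *\<^sub>L v j \<in> G (Suc k)"
        by (rule G_add)
      then show ?thesis using 1 by (simp add: algebra_simps)
    next
      case 2
      have "f \<bullet> z - (2 * \<kappa>) *\<^sub>L f \<in> G (Suc k)"
        using weight_action_f[OF z] G_mono[of "Suc k" 3] 2 by simp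
      moreover have "((2 - of_nat k) * \<kappa>) *\<^sub>L f \<in> G (Suc k)"
        using 2 by (cases "k = 2") (simp_all add: G_scale f_G)
      ultimately have "(f \<bullet> z - (2 * \<kappa>) *\<^sub>L f) + ((2 - of_nat k) * \<kappa>) *\<^sub>L f \<in> G (Suc k)"
        by (rule G_add)
      then show ?thesis using 2 by (simp add: algebra_simps)
    qed
  qed
  have "u \<in> S \<and> u \<bullet> z - (of_nat k * \<kappa>) *\<^sub>L u \<in> G (Suc k)"
    using assms(4) unfolding flag_def[of y f k]
  proof (induction rule: span_induct_alt)
    case (step c h w)
    have "(c *\<^sub>L h + w) \<bullet> z - (of_nat k * \<kappa>) *\<^sub>L (c *\<^sub>L h + w) =
        c *\<^sub>L (h \<bullet> z - (of_nat k * \<kappa>) *\<^sub>L h) + (w \<bullet> z - (of_nat k * \<kappa>) *\<^sub>L w)"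
      using gen[OF step(1)] step(2) by (simp add: algebra_simps)
    moreover have "\<dots> \<in> G (Suc k)"
      using gen[OF step(1)] step(2) by (intro G_add G_scale) auto
    ultimately show ?case using gen[OF step(1)] step(2) by (simp only:) simp
  qed simp
  then show ?thesis ..
qed

end

section \<open>The nilradical as the positive part\<close>

context leibniz_super
begin

lemma subspace_preimage:
  assumes "subspace T" "u \<in> S"
  shows "subspace {z \<in> S. u \<bullet> z \<in> T}"
  unfolding subspace_def
  using assms by (auto intro: subspace_0 subspace_add subspace_scale)

lemma product_space_subset:
  assumes "subspace T" "\<And>u w. u \<in> A \<Longrightarrow> w \<in> B \<Longrightarrow> u \<bullet> w \<in> T"
  shows "product_space L A B \<subseteq> T"
  unfolding product_space_def using assms by (intro span_minimal) auto

lemma space_of_restrict_to_subset: "subspace T \<Longrightarrow> space_of (restrict_to L T) \<subseteq> T"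
  by (auto simp: space_of_def restrict_to_def intro: subspace_add)

lemma product_space_restrict_to [simp]: "product_space (restrict_to L T) A B = product_space L A B"
  by (simp add: product_space_def restrict_to_def)

end

context filiform_radical
begin

text \<open>
  The elements on which the scalar \<open>\<kappa>\<close> vanishes: those that raise weights when they multiply from the
  right.
\<close>

definition positive_part :: "'v set" where
  "positive_part = {z \<in> S. y \<bullet> z \<in> G 2}"

lemma subspace_positive_part: "subspace positive_part"
  unfolding positive_part_def by (intro subspace_preimage subspace_G y_S)

text \<open>
  For odd \<open>z\<close> the product \<open>[y,z]\<close> is even, whereas the only generator of weight \<open>1\<close> is odd.
\<close>

lemma odd_positive: "z \<in> part L 1 \<Longrightarrow> z \<in> positive_part"
  unfolding positive_part_def using br_part[OF y_odd, of z 1] part_S[of z 1]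
  by (auto intro!: even_G2 br_G1)

lemma G1_positive: "z \<in> G 1 \<Longrightarrow> z \<in> positive_part"
proof -
  assume z: "z \<in> G 1"
  then obtain c where c: "z - c *\<^sub>L y \<in> G 2" using G1_split by blast
  then have "y \<bullet> (z - c *\<^sub>L y) \<in> G 2"
    using G_G2[OF y_G1 _ c] G_mono[of 2 "1 + 2"] by simp
  then have "y \<bullet> (z - c *\<^sub>L y) + c *\<^sub>L v 2 \<in> G 2" by (simp add: G_add G_scale v_G)
  then show ?thesis using G_S[OF z] by (simp add: positive_part_def y_y)
qed

lemma positive_raises:
  assumes "z \<in> positive_part" "u \<in> G k" "k \<ge> 1"
  shows "u \<bullet> z \<in> G (Suc k)"
proof -
  have zS: "z \<in> S" using assms(1) by (simp add: positive_part_def)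
  obtain z0 z1 where d: "z = z0 + z1" "z0 \<in> part L 0" "z1 \<in> part L 1"
    using S_decompose[OF zS] .
  have z1: "z1 \<in> positive_part" using d odd_positive by blast
  have "z0 \<in> positive_part"
    using subspace_diff[OF subspace_positive_part assms(1) z1] d by simp
  then have "u \<bullet> z0 \<in> G (Suc k)"
    using weight_action[of z0 0 0 u k] assms d by (simp add: positive_part_def)
  moreover have "u \<bullet> z1 \<in> G (Suc k)"
    using weight_action[of z1 1 0 u k] assms d z1 by (simp add: positive_part_def)
  ultimately show ?thesis using d assms G_S by (simp add: part_S G_add)
qed

lemma lower_series_positive_part:
  "lower_series (restrict_to L positive_part) (Suc k) \<subseteq> G (Suc k)"
proof (induction k)
  case 0
  have "space_of (restrict_to L positive_part) \<subseteq> S"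
    using space_of_restrict_to_subset[OF subspace_positive_part] by (auto simp: positive_part_def)
  then show ?case
    unfolding lower_series.simps product_space_restrict_to
    unfolding One_nat_def[symmetric]
    by (intro product_space_subset subspace_G derived) auto
next
  case (Suc k)
  then show ?case
    unfolding lower_series.simps(2)[of _ "Suc k"] product_space_restrict_to
    using space_of_restrict_to_subset[OF subspace_positive_part]
    by (intro product_space_subset[OF subspace_G]) (auto intro!: positive_raises)
qed

text \<open>
  An Engel argument: each step of the lower central series raises the weight. As the positive part
  contains the derived algebra, it is a nilpotent ideal.
\<close>

lemma nilradical_candidate_positive_part: "nilradical_candidate L positive_part"
  unfolding nilradical_candidate_def
proof (intro conjI)
  show "graded_ideal L positive_part"
    unfolding graded_ideal_def
  proof (intro conjI ballI)
    show "space_of (restrict_to L positive_part) = positive_part"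
    proof
      show "positive_part \<subseteq> space_of (restrict_to L positive_part)"
      proof
        fix z assume z: "z \<in> positive_part"
        then have "z \<in> S" by (simp add: positive_part_def)
        then obtain z0 z1 where d: "z = z0 + z1" "z0 \<in> part L 0" "z1 \<in> part L 1"
          using S_decompose by blast
        have "z1 \<in> positive_part" using d odd_positive by blast
        moreover from this have "z0 \<in> positive_part"
          using subspace_diff[OF subspace_positive_part z] d by (metis add_diff_cancel_right')
        ultimately show "z \<in> space_of (restrict_to L positive_part)"
          using d by (auto simp: space_of_def restrict_to_def)
      qed
    qed (rule space_of_restrict_to_subset[OF subspace_positive_part])
  qed (auto simp: subspace_positive_part intro!: G1_positive derived, auto simp: positive_part_def)
  have "lower_series (restrict_to L positive_part) (Suc m) \<subseteq> {0}"
    using lower_series_positive_part[of m] G_beyond[of "Suc m"] by simp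
  moreover have "0 \<in> lower_series (restrict_to L positive_part) (Suc m)"
    unfolding lower_series.simps product_space_restrict_to
    by (simp add: product_space_def span_zero)
  ultimately show "super_nilpotent (restrict_to L positive_part)"
    unfolding super_nilpotent_def by blast
  show "product_space L S S \<subseteq> positive_part"
    by (intro product_space_subset subspace_positive_part G1_positive derived)
qed

lemma nilradical_eq_positive_part:
  assumes "is_nilradical L (G 1)" shows "G 1 = positive_part"
  using assms nilradical_candidate_positive_part G1_positive unfolding is_nilradical_def by blast

text \<open>
  By maximality the nilradical is the whole positive part, that is, the kernel of the linear form \<open>\<kappa>\<close>.
  It has codimension at most one, and codimension exactly one if the superalgebra is not nilpotent;
  since odd elements are in the kernel, a complement is spanned by an even element, which can be scaled
  to \<open>\<kappa> = 1\<close>.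
\<close>

lemma exists_toral_element:
  assumes nil: "is_nilradical L (G 1)" and "\<not> super_nilpotent L"
  obtains x where "x \<in> part L 0" "y \<bullet> x - y \<in> G 2" "x \<notin> G 1"
    "\<And>w. w \<in> S \<Longrightarrow> \<exists>c. w - c *\<^sub>L x \<in> G 1"
proof -
  note pos = nilradical_eq_positive_part[OF nil]
  have "\<not> S \<subseteq> G 1"
  proof
    assume "S \<subseteq> G 1"
    then have "restrict_to L (G 1) = L"
      using part_S by (fastforce simp: restrict_to_def intro!: superalgebra.equality ext)
    then show False using nil assms(2) by (simp add: is_nilradical_def nilradical_candidate_def)
  qed
  then obtain z where z: "z \<in> S" "z \<notin> G 1" by blast
  obtain z0 z1 where d: "z = z0 + z1" "z0 \<in> part L 0" "z1 \<in> part L 1"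
    using S_decompose[OF z(1)] .
  have z0: "z0 \<in> S" "z0 \<notin> G 1"
    using d z odd_positive[of z1] pos G_add[of z0 1 z1] part_S by auto
  obtain \<kappa> where \<kappa>: "y \<bullet> z0 - \<kappa> *\<^sub>L y \<in> G 2"
    using G1_split[OF derived[OF y_S z0(1)]] .
  have \<kappa>0: "\<kappa> \<noteq> 0"
  proof
    assume "\<kappa> = 0"
    then have "z0 \<in> positive_part" using \<kappa> z0(1) by (simp add: positive_part_def)
    then show False using z0(2) pos by blast
  qed
  define x where "x = inverse \<kappa> *\<^sub>L z0"
  have x: "x \<in> part L 0" "x \<in> S" using d z0 by (simp_all add: x_def part_scale)
  have yx: "y \<bullet> x - y \<in> G 2"
    using G_scale[OF \<kappa>, of "inverse \<kappa>"] \<kappa>0 z0 by (simp add: x_def scale_right_diff_distrib)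
  show thesis
  proof (rule that[OF x(1) yx])
    show "x \<notin> G 1"
      using G_scale[of x 1 \<kappa>] \<kappa>0 z0 by (auto simp: x_def)
    fix w assume w: "w \<in> S"
    obtain c where c: "y \<bullet> w - c *\<^sub>L y \<in> G 2"
      using G1_split[OF derived[OF y_S w]] .
    have "(y \<bullet> w - c *\<^sub>L y) - c *\<^sub>L (y \<bullet> x - y) \<in> G 2"
      by (rule G_diff[OF c G_scale[OF yx]])
    then have "y \<bullet> (w - c *\<^sub>L x) \<in> G 2"
      using w x by (simp add: scale_right_diff_distrib)
    then have "w - c *\<^sub>L x \<in> positive_part" using w x by (simp add: positive_part_def)
    then have "w - c *\<^sub>L x \<in> G 1" using pos by blast
    then show "\<exists>c. w - c *\<^sub>L x \<in> G 1" ..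
  qed
qed

end

section \<open>Diagonalization and normalization\<close>

context filiform_radical
begin

text \<open>
  On weight \<open>j\<close> the operator \<open>[-,x] - c\<close> acts by \<open>j - c\<close>, which is invertible for \<open>j > c\<close>. An
  approximate eigenvector is therefore corrected weight by weight. The vector \<open>u\<close> is allowed to lie
  outside the radical: this covers both the choice of new generators and the correction of \<open>x\<close> itself.
\<close>

lemma eigen_lift:
  assumes x: "x \<in> part L 0" "y \<bullet> x - y \<in> G 2"
    and "c < k" "u \<in> part L a" "u \<bullet> x - of_nat c *\<^sub>L u \<in> G k"
  obtains g where "g \<in> G k" "g \<in> part L a" "(u + g) \<bullet> x = of_nat c *\<^sub>L (u + g)"
proof -
  have "\<exists>g. g \<in> G k \<and> g \<in> part L a \<and> (u + g) \<bullet> x = of_nat c *\<^sub>L (u + g)"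
    using assms(3-5)
  proof (induction "Suc m - k" arbitrary: k u)
    case 0
    then have "u \<bullet> x - of_nat c *\<^sub>L u = 0" using G_beyond[of k] by auto
    then show ?case by (intro exI[of _ 0]) simp
  next
    case (Suc d)
    have xS: "x \<in> S" using x part_S by blast
    have uS: "u \<in> S" using Suc.prems part_S by blast
    define w where "w = u \<bullet> x - of_nat c *\<^sub>L u"
    have w: "w \<in> G k" "w \<in> part L a"
      using Suc.prems br_part[OF Suc.prems(2) x(1), unfolded add_0_right]
      by (simp_all add: w_def part_diff part_scale)
    have wS: "w \<in> S" using w part_S by blast
    define r where "r = w \<bullet> x - of_nat k *\<^sub>L w"
    have r: "r \<in> G (Suc k)"
      using weight_action[of x 0 1 w k] x w Suc.prems by (simp add: r_def)
    define t :: complex where "t = inverse (of_nat k - of_nat c)"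
    have t: "t * (of_nat k - of_nat c) = 1" using Suc.prems by (simp add: t_def)
    define u' where "u' = u - t *\<^sub>L w"
    have "u' \<bullet> x - of_nat c *\<^sub>L u' = w - t *\<^sub>L (r + of_nat k *\<^sub>L w) + (t * of_nat c) *\<^sub>L w"
      using uS wS xS by (simp add: u'_def w_def[symmetric] r_def scale_right_diff_distrib mult.commute)
    also have "\<dots> = w - (t * (of_nat k - of_nat c)) *\<^sub>L w - t *\<^sub>L r"
      by (simp add: algebra_simps)
    finally have "u' \<bullet> x - of_nat c *\<^sub>L u' = - (t *\<^sub>L r)" using t by simp
    then have "u' \<bullet> x - of_nat c *\<^sub>L u' \<in> G (Suc k)" using r by (simp add: G_neg G_scale)
    moreover have "u' \<in> part L a" using Suc.prems w by (simp add: u'_def part_diff part_scale)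
    moreover have "d = Suc m - Suc k" "c < Suc k" using Suc.hyps(2) Suc.prems(1) by simp_all
    ultimately obtain g where g: "g \<in> G (Suc k)" "g \<in> part L a" "(u' + g) \<bullet> x = of_nat c *\<^sub>L (u' + g)"
      using Suc.hyps(1) by blast
    have "g - t *\<^sub>L w \<in> G k"
      using G_mono[of k "Suc k" g] g w by (simp add: G_diff G_scale)
    moreover have "g - t *\<^sub>L w \<in> part L a" using g w by (simp add: part_diff part_scale)
    moreover have "u' + g = u + (g - t *\<^sub>L w)" by (simp add: u'_def)
    ultimately show ?case using g(3) by metis
  qed
  then show ?thesis using that by blast
qed

text \<open>
  The same invertibility: an eigenvector with eigenvalue \<open>c\<close> cannot have all its weights above \<open>c\<close>.
\<close>

lemma eigen_unique:
  assumes x: "x \<in> part L 0" "y \<bullet> x - y \<in> G 2"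
    and "c < k" "u \<in> G k" "u \<bullet> x = of_nat c *\<^sub>L u"
  shows "u = 0"
proof -
  have "u \<in> G (k + i)" for i
  proof (induction i)
    case (Suc i)
    have "u \<bullet> x - of_nat (k + i) *\<^sub>L u \<in> G (Suc (k + i))"
      using weight_action[of x 0 1 u "k + i"] x Suc assms(3) by simp
    then have "(of_nat c - of_nat (k + i)) *\<^sub>L u \<in> G (Suc (k + i))"
      using assms(5) by (simp add: algebra_simps)
    then have "inverse (of_nat c - of_nat (k + i)) *\<^sub>L (of_nat c - of_nat (k + i)) *\<^sub>L u \<in> G (Suc (k + i))"
      by (rule G_scale)
    moreover have "of_nat c - of_nat (k + i) \<noteq> (0 :: complex)"
      using assms(3) by (metis eq_iff_diff_eq_0 not_add_less1 of_nat_eq_iff)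
    ultimately show ?case by simp
  qed (use assms in simp)
  from this[of "Suc m"] show ?thesis using G_beyond[of "k + Suc m"] by simp
qed

text \<open>
  Elements of weight at least \<open>3\<close> annihilate from the right, so \<open>y'\<close> multiplies on the right
  like \<open>y\<close>, and \<open>f'\<close> like \<open>f\<close>. The new powers differ from the old ones by higher weights and the
  filtration is unchanged. The one relation that is not inherited is the value of \<open>[f',y']\<close>.
\<close>

lemma change_generators:
  assumes y': "y' \<in> part L 1" "y' - y \<in> G 3"
    and f': "f' \<in> part L 0" "f' - f \<in> G 3"
    and rel: "f' \<bullet> y' = rpow y' 3"
  shows "filiform_radical L y' f' m" "\<And>k. k \<ge> 1 \<Longrightarrow> flag y' f' k = G k"
proof -
  have S' [simp]: "y' \<in> S" "f' \<in> S" using y' f' part_S by auto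
  have R: "u \<bullet> y' = u \<bullet> y" if "u \<in> S" for u
    using br_G3[OF y'(2) that] that by simp
  have diff: "rpow y' k \<in> S \<and> rpow y' k - v k \<in> G (Suc k)" if "k \<ge> 1" for k
    using that
  proof (induction k rule: dec_induct)
    case base
    then show ?case using G_mono[of 2 3] y'(2) by (simp add: numeral_2_eq_2)
  next
    case (step k)
    then have "rpow y' (Suc k) - v (Suc k) = (rpow y' k - v k) \<bullet> y"
      by (simp add: rpow_Suc R)
    then show ?case using step G_y[of "rpow y' k - v k" "Suc k"] by (simp add: rpow_Suc)
  qed
  have sub: "flag y' f' k \<subseteq> G k" if "k \<ge> 1" for k
    unfolding flag_def[of y']
  proof (rule span_minimal[OF _ subspace_G], rule subsetI)
    fix h assume h: "h \<in> flag_gens y' f' k"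
    then consider j where "j \<ge> k" "h = rpow y' j" | "k \<le> 2" "h = f'"
      by (auto simp: flag_gens_def split: if_splits)
    then show "h \<in> G k"
    proof cases
      case 1
      then have "v j + (rpow y' j - v j) \<in> G k"
        using diff[of j] that G_mono[of k "Suc j"] by (intro G_add v_G) auto
      then show ?thesis using 1 by simp
    next
      case 2
      then have "f + (f' - f) \<in> G k"
        using f' G_mono[of k 3] by (intro G_add f_G) auto
      then show ?thesis using 2 by simp
    qed
  qed
  have sup: "G k \<subseteq> flag y' f' k" if "k \<ge> 1" for k
    using that
  proof (induction "Suc m - k" arbitrary: k)
    case 0
    then show ?case using G_beyond[of k] by (simp add: flag_def span_zero)
  next
    case (Suc d)
    have IH: "G (Suc k) \<subseteq> flag y' f' (Suc k)" using Suc by simp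
    have mono: "flag y' f' (Suc k) \<subseteq> flag y' f' k" by (simp add: flag_mono)
    show ?case
      unfolding flag_def[of y f k]
    proof (rule span_minimal, rule subsetI)
      fix h assume h: "h \<in> flag_gens y f k"
      then consider "h = v k" | j where "j \<ge> Suc k" "h = v j" | "k \<le> 2" "h = f"
        by (auto simp: flag_gens_def Suc_le_eq split: if_splits) (metis le_neq_implies_less)+
      then show "h \<in> flag y' f' k"
      proof cases
        case 1
        have "rpow y' k - (rpow y' k - v k) \<in> flag y' f' k"
          by (rule flag_diff) (use diff[OF Suc.prems] IH mono in \<open>auto intro: rpow_flag\<close>)
        then show ?thesis using 1 by simp
      next
        case 2
        then show ?thesis using v_G[of "Suc k" j] IH mono by blast
      next
        case 3
        have "f' - (f' - f) \<in> flag y' f' k"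
          by (rule flag_diff) (use f' IH mono G_mono[of "Suc k" 3] 3 in \<open>auto intro: generator_flag\<close>)
        then show ?thesis using 3 by simp
      qed
    qed (simp add: flag_def)
  qed
  have eq: "flag y' f' k = G k" if "k \<ge> 1" for k
    using sub[OF that] sup[OF that] by blast
  then show "k \<ge> 1 \<Longrightarrow> flag y' f' k = G k" for k .
  show "filiform_radical L y' f' m"
  proof
    show "y' \<in> part L 1" "f' \<in> part L 0" "m \<ge> 3" "f' \<bullet> y' = rpow y' 3"
      using y' f' rel m_ge_3 by auto
    show "u \<bullet> f' = 0" if "u \<in> flag y' f' 1" for u
    proof -
      have "u \<in> G 1" using that eq by simp
      then show ?thesis using radical_f[of u] br_G3[OF f'(2), of u] G_S[of u] by simp
    qed
    show "rpow y' m \<noteq> 0"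
      using diff[of m] m_ge_3 rpow_m G_beyond[of "Suc m"] by simp
    show "rpow y' (Suc m) = 0"
      using diff[of "Suc m"] rpow_Suc_m G_beyond[of "Suc (Suc m)"] by simp
    show "u \<bullet> w \<in> flag y' f' 1" if "u \<in> S" "w \<in> S" for u w
      using derived[OF that] eq by simp
  qed
qed

lemma rpow_eigen:
  assumes "x \<in> part L 0" "y \<bullet> x = y" "k \<ge> 1"
  shows "v k \<bullet> x = of_nat k *\<^sub>L v k"
  using assms(3)
proof (induction k rule: dec_induct)
  case base
  then show ?case using assms by simp
next
  case (step k)
  have "v k \<bullet> (y \<bullet> x) = (v k \<bullet> y) \<bullet> x - (v k \<bullet> x) \<bullet> y"
    using leibniz_even[OF v_S y_odd assms(1)] by simp
  then have "v (Suc k) \<bullet> x = v (Suc k) + of_nat k *\<^sub>L v (Suc k)"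
    using step assms by (simp add: v_Suc algebra_simps)
  then show ?case by (simp add: scale_left_distrib)
qed

text \<open>
  Eigenvectors \<open>y'\<close> and \<open>f'\<close> of right multiplication by \<open>x\<close> exist by lifting. Both \<open>[f',y']\<close> and the
  third power of \<open>y'\<close> are then eigenvectors with eigenvalue \<open>3\<close> that agree in weight \<open>3\<close>, so they are equal
  and the change of generators is admissible.
\<close>

lemma diagonalize:
  assumes x: "x \<in> part L 0" "y \<bullet> x - y \<in> G 2"
  obtains y' f' where "filiform_radical L y' f' m" "flag y' f' 1 = G 1"
    "y' \<bullet> x = y'" "f' \<bullet> x = 2 *\<^sub>L f'"
proof -
  have xS [simp]: "x \<in> S" using x part_S by blast
  have "y \<bullet> x - y \<in> part L 1" using br_part[OF y_odd x(1)] y_odd part_diff by simp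
  then have "y \<bullet> x - y \<in> G 3" using x odd_G3 by blast
  then obtain g where g: "g \<in> G 3" "g \<in> part L 1" "(y + g) \<bullet> x = y + g"
    using eigen_lift[OF x, of 1 3 y 1] y_odd by auto
  define y' where "y' = y + g"
  have y': "y' \<in> part L 1" "y' - y \<in> G 3" "y' \<bullet> x = y'"
    using g y_odd by (simp_all add: y'_def part_add)
  have "f \<bullet> x - 2 *\<^sub>L f \<in> G 3" using weight_action[of x 0 1 f 2] x f_G[of 2] by simp
  then obtain h where h: "h \<in> G 3" "h \<in> part L 0" "(f + h) \<bullet> x = 2 *\<^sub>L (f + h)"
    using eigen_lift[OF x, of 2 3 f 0] f_even by auto
  define f' where "f' = f + h"
  have f': "f' \<in> part L 0" "f' - f \<in> G 3" "f' \<bullet> x = 2 *\<^sub>L f'"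
    using h f_even by (simp_all add: f'_def part_add)
  have S': "y' \<in> S" "f' \<in> S" using y' f' part_S by auto
  have R: "u \<bullet> y' = u \<bullet> y" if "u \<in> S" for u
    using br_G3[OF y'(2) that] that S' by simp
  have step: "u \<bullet> y' \<bullet> x = (c + 1) *\<^sub>L (u \<bullet> y')" if "u \<in> S" "u \<bullet> x = c *\<^sub>L u" for u c
    using leibniz_even[OF that(1) y'(1) x(1)] that y'(3) S' by (simp add: algebra_simps)
  have r3: "rpow y' 3 = y' \<bullet> y' \<bullet> y'" by (simp add: rpow_def eval_nat_numeral)
  have "rpow y' 3 \<bullet> x = 3 *\<^sub>L rpow y' 3"
    using step[of "y' \<bullet> y'" 2] step[of y' 1] S' y'(3) by (simp add: r3)
  moreover have "f' \<bullet> y' \<bullet> x = 3 *\<^sub>L (f' \<bullet> y')"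
    using step[of f' 2] S' f'(3) by simp
  ultimately have ev: "(f' \<bullet> y' - rpow y' 3) \<bullet> x = of_nat 3 *\<^sub>L (f' \<bullet> y' - rpow y' 3)"
    using S' by (simp add: r3 scale_right_diff_distrib)
  have "f' \<bullet> y' - rpow y' 3 = h \<bullet> y - g \<bullet> y \<bullet> y"
    using S' G_S[OF g(1)] G_S[OF h(1)] by (simp add: r3 R f_y) (simp add: f'_def y'_def f_y y_y v2_y)
  moreover have "h \<bullet> y - g \<bullet> y \<bullet> y \<in> G 4"
    using G_y[OF h(1)] G_y[OF G_y[OF g(1)]] G_mono[of 4 5] by (auto intro!: G_diff)
  ultimately have mem: "f' \<bullet> y' - rpow y' 3 \<in> G 4" by (simp only:)
  have "f' \<bullet> y' - rpow y' 3 = 0" by (rule eigen_unique[OF x _ mem ev]) simp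
  then have rel: "f' \<bullet> y' = rpow y' 3" by simp
  show thesis
    using that change_generators[OF y'(1,2) f'(1,2) rel] y'(3) f'(3) by simp
qed

text \<open>
  From \<open>[x,[f,x]] = [[x,f],x]\<close> the vector \<open>[x,f]\<close> has eigenvalue \<open>2\<close>, so it is a combination of \<open>f\<close> and
  \<open>v\<^sub>2\<close>. The products \<open>[y,[x,f]]\<close> and \<open>[[x,f],y]\<close> vanish, and they detect the two
  coefficients.
\<close>

lemma left_multiplication_f:
  assumes x: "x \<in> part L 0" "y \<bullet> x = y" "f \<bullet> x = 2 *\<^sub>L f"
  shows "x \<bullet> f = 0"
proof -
  have xS [simp]: "x \<in> S" using x part_S by blast
  have x2: "y \<bullet> x - y \<in> G 2" using x by simp
  define u where "u = x \<bullet> f"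
  have u: "u \<in> G 1" "u \<in> S" "u \<in> part L 0"
    using br_part[OF x(1) f_even] derived[of x f] by (simp_all add: u_def)
  have "x \<bullet> (f \<bullet> x) = u \<bullet> x - (x \<bullet> x) \<bullet> f"
    using leibniz_even[OF xS f_even x(1)] by (simp add: u_def)
  then have ux: "u \<bullet> x = 2 *\<^sub>L u"
    using radical_f[OF derived[OF xS xS]] x(3) by (simp add: u_def)
  obtain a b where ab: "u - a *\<^sub>L f - b *\<^sub>L v 2 \<in> G 3"
    using G2_split[OF even_G2[OF u(1,3)]] .
  have "(u - a *\<^sub>L f - b *\<^sub>L v 2) \<bullet> x = of_nat 2 *\<^sub>L (u - a *\<^sub>L f - b *\<^sub>L v 2)"
    using u ux x rpow_eigen[of x 2] by (simp add: scale_right_diff_distrib mult.commute)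
  then have "u - a *\<^sub>L f - b *\<^sub>L v 2 = 0" 
    by (rule eigen_unique[where c = 2, OF x(1) x2 _ ab, rotated]) simp
  then have u_eq: "u = a *\<^sub>L f + b *\<^sub>L v 2" by (simp add: algebra_simps)
  have "y \<bullet> u = y \<bullet> x \<bullet> f - y \<bullet> f \<bullet> x"
    using leibniz_even[OF y_S x(1) f_even] by (simp add: u_def)
  then have "y \<bullet> u = 0" using radical_f[OF y_G1] x by simp
  then have "b = 0"
    using radical_f[OF y_G1] v_nonzero[of 3] m_ge_3 by (simp add: u_eq br_v2 y_y v2_y)
  moreover have "x \<bullet> (f \<bullet> y) = u \<bullet> y - x \<bullet> y \<bullet> f"
    using leibniz_even[OF xS f_even y_odd] by (simp add: u_def)
  then have "u \<bullet> y = 0" using br_v_ge3[of 3 x] radical_f[OF derived[of x y]] by (simp add: f_y)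
  ultimately have "a = 0"
    using v_nonzero[of 3] m_ge_3 by (simp add: u_eq f_y)
  with \<open>b = 0\<close> show ?thesis by (simp add: u_eq flip: u_def)
qed

text \<open>
  The square \<open>[x,x]\<close> has no \<open>v\<^sub>2\<close>-component because \<open>[y,[x,x]] = 0\<close>. The other components lie where
  right multiplication by \<open>x\<close> is invertible, and where right multiplication by the correcting element vanishes;
  so \<open>x\<close> can be corrected to have square zero without changing its right action. Then \<open>[x',y]\<close> is
  an eigenvector with eigenvalue \<open>1\<close>, hence a multiple of \<open>y\<close>, and the Leibniz identity for
  \<open>[y,[x',y]]\<close> makes the factor \<open>-1\<close>.
\<close>

lemma normalize_toral_element:
  assumes x: "x \<in> part L 0" "y \<bullet> x = y" "f \<bullet> x = 2 *\<^sub>L f"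
  obtains x' where "x' \<in> part L 0" "x' - x \<in> G 1" "y \<bullet> x' = y" "f \<bullet> x' = 2 *\<^sub>L f"
    "x' \<bullet> x' = 0" "x' \<bullet> f = 0" "x' \<bullet> y = - y"
proof -
  have xS [simp]: "x \<in> S" using x part_S by blast
  have x2: "y \<bullet> x - y \<in> G 2" using x by simp
  have xx: "x \<bullet> x \<in> G 2"
    using even_G2[OF derived[OF xS xS]] br_part[OF x(1,1)] by simp
  obtain a b where ab: "x \<bullet> x - a *\<^sub>L f - b *\<^sub>L v 2 \<in> G 3"
    using G2_split[OF xx] .
  have "y \<bullet> (x \<bullet> x) = 0" using leibniz_even[OF y_S x(1) x(1)] by simp
  then have "b = 0"
    using br_G3[OF ab y_S] radical_f[OF y_G1] v_nonzero[of 3] m_ge_3 by (simp add: br_v2 y_y v2_y)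
  define x1 where "x1 = x - (a / 2) *\<^sub>L f"
  have x1: "x1 \<in> part L 0" using x f_even by (simp add: x1_def part_diff part_scale)
  \<comment> \<open>the eigenvalue of \<open>f\<close> is \<open>2\<close>, hence half of its coefficient; the rest of the square has weight at least \<open>3\<close> and is lifted to eigenvalue \<open>0\<close>\<close>
  have "x1 \<bullet> x - of_nat 0 *\<^sub>L x1 \<in> G 3"
    using ab \<open>b = 0\<close> x by (simp add: x1_def)
  then obtain g where g: "g \<in> G 3" "g \<in> part L 0" "(x1 + g) \<bullet> x = 0"
    using eigen_lift[OF x(1) x2 _ x1, of 0 3] by auto
  have gS [simp]: "g \<in> S" using g part_S by blast
  define x' where "x' = x1 + g"
  have x': "x' \<in> part L 0" using x1 g by (simp add: x'_def part_add)
  have x'S [simp]: "x' \<in> S" using x' part_S by blast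
  have right: "u \<bullet> x' = u \<bullet> x" if "u \<in> G 1" for u
    using br_G3[OF g(1)] G_S[OF that] radical_f[OF that] by (simp add: x'_def x1_def)
  have yx': "y \<bullet> x' = y" "f \<bullet> x' = 2 *\<^sub>L f" using right y_G1 f_G[of 1] x by auto
  have d: "x' - x = g - (a / 2) *\<^sub>L f" by (simp add: x'_def x1_def)
  have x'f: "x' \<bullet> f = 0" using left_multiplication_f[OF x' yx'] .
  have "x' \<bullet> x' = x' \<bullet> x + x' \<bullet> (x' - x)" by simp
  also have "\<dots> = 0" using g(3) br_G3[OF g(1), of x'] x'f by (simp add: d flip: x'_def)
  finally have x'x': "x' \<bullet> x' = 0" .
  define u where "u = x' \<bullet> y"
  have u: "u \<in> G 1" "u \<in> S"
    using derived[of x' y] by (simp_all add: u_def)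
  have "x' \<bullet> (y \<bullet> x') = u \<bullet> x' - x' \<bullet> x' \<bullet> y"
    using leibniz_even[OF x'S y_odd x'] by (simp add: u_def)
  then have ux: "u \<bullet> x' = u" using x'x' yx' by (simp add: u_def)
  obtain c where c: "u - c *\<^sub>L y \<in> G 2"
    using G1_split[OF u(1)] .
  have "(u - c *\<^sub>L y) \<bullet> x' = of_nat 1 *\<^sub>L (u - c *\<^sub>L y)"
    using u ux yx' by simp
  then have "u - c *\<^sub>L y = 0" using eigen_unique[OF x' _ _ c, of 1] yx' by simp
  then have u_eq: "u = c *\<^sub>L y" by simp
  have "y \<bullet> u = y \<bullet> x' \<bullet> y - y \<bullet> y \<bullet> x'"
    using leibniz_even[OF y_S x' y_odd] by (simp add: u_def)
  then have "c *\<^sub>L v 2 = v 2 - 2 *\<^sub>L v 2"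
    using yx' rpow_eigen[OF x', of 2] by (simp add: u_eq y_y)
  then have "(c - 1 + 2) *\<^sub>L v 2 = 0" by (simp only: scale_left_distrib scale_left_diff_distrib) simp
  then have "c = -1" using v_nonzero[of 2] m_ge_3 by (simp add: eq_neg_iff_add_eq_0 add.commute)
  then have "x' \<bullet> y = - y" using u_eq by (simp add: u_def)
  moreover have "x' - x \<in> G 1"
    using G_mono[of 1 3 g] g(1) f_G[of 1] by (simp add: d G_diff G_scale)
  ultimately show thesis using that[OF x' _ yx' x'x' x'f] by blast
qed

end

section \<open>Tables and bases\<close>

text \<open>
  The operations of \<open>K\<close> are unconstrained outside its space, so closure of the space has to be known
  before the inverse map can be compared with sums and products of preimages.
\<close>

lemma superalgebra_iso_sym:
  assumes iso: "superalgebra_iso K K' \<phi>"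
    and part: "\<And>a. part K a \<subseteq> space_of K"
    and add: "\<And>u w. u \<in> space_of K \<Longrightarrow> w \<in> space_of K \<Longrightarrow> u + w \<in> space_of K"
    and scale: "\<And>c u. u \<in> space_of K \<Longrightarrow> scal K c u \<in> space_of K"
    and br: "\<And>u w. u \<in> space_of K \<Longrightarrow> w \<in> space_of K \<Longrightarrow> br K u w \<in> space_of K"
  shows "superalgebra_iso K' K (inv_into (space_of K) \<phi>)"
proof -
  let ?\<psi> = "inv_into (space_of K) \<phi>"
  have bij: "bij_betw \<phi> (space_of K) (space_of K')" using iso by (simp add: superalgebra_iso_def)
  then have inj: "inj_on \<phi> (space_of K)" and surj: "\<phi> ` space_of K = space_of K'"
    by (auto simp: bij_betw_def)
  have \<psi>: "?\<psi> u \<in> space_of K" "\<phi> (?\<psi> u) = u" if "u \<in> space_of K'" for u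
    using that surj by (auto intro: inv_into_into f_inv_into_f)
  have eq: "?\<psi> w = u" if "u \<in> space_of K" "\<phi> u = w" for u w
    using inv_into_f_f[OF inj that(1)] that(2) by simp
  show ?thesis
    unfolding superalgebra_iso_def
  proof (intro conjI allI ballI)
    show "bij_betw ?\<psi> (space_of K') (space_of K)" using bij by (rule bij_betw_inv_into)
    show "?\<psi> ` part K' a = part K a" for a
    proof -
      have "part K' a = \<phi> ` part K a" using iso by (simp add: superalgebra_iso_def)
      then show ?thesis using inv_into_image_cancel[OF inj part] by simp
    qed
  next
    fix u w assume u: "u \<in> space_of K'" and w: "w \<in> space_of K'"
    show "?\<psi> (u + w) = ?\<psi> u + ?\<psi> w"
      using iso add \<psi>[OF u] \<psi>[OF w] by (intro eq) (auto simp: superalgebra_iso_def)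
    show "?\<psi> (br K' u w) = br K (?\<psi> u) (?\<psi> w)"
      using iso br \<psi>[OF u] \<psi>[OF w] by (intro eq) (auto simp: superalgebra_iso_def)
  next
    fix c u assume u: "u \<in> space_of K'"
    show "?\<psi> (scal K' c u) = scal K c (?\<psi> u)"
      using iso scale \<psi>[OF u] by (intro eq) (auto simp: superalgebra_iso_def)
  qed
qed

lemma space_of_table:
  "space_of (table_superalgebra B T) = {c. \<forall>i. i \<notin> B 0 \<union> B 1 \<longrightarrow> c i = 0}"
proof -
  have "\<exists>u w. c = u + w \<and> (\<forall>i. i \<notin> B 0 \<longrightarrow> u i = 0) \<and> (\<forall>i. i \<notin> B 1 \<longrightarrow> w i = 0)"
    if "\<forall>i. i \<notin> B 0 \<union> B 1 \<longrightarrow> c i = 0" for c :: "'a \<Rightarrow> complex"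
    using that by (intro exI[of _ "\<lambda>i. if i \<in> B 0 then c i else 0"] exI[of _ "\<lambda>i. if i \<in> B 0 then 0 else c i"])
      (auto simp: fun_eq_iff)
  then show ?thesis
    unfolding space_of_def table_superalgebra_def by auto
qed

lemma coord_in_table:
  "i \<in> B a \<Longrightarrow> coord c i \<in> part (table_superalgebra B T) a"
  by (auto simp: table_superalgebra_def coord_def)

lemma br_table_coord:
  assumes "finite (B 0 \<union> B 1)" "i \<in> B 0 \<union> B 1" "j \<in> B 0 \<union> B 1"
  shows "br (table_superalgebra B T) (coord 1 i) (coord 1 j) = T i j"
proof
  fix k
  have "br (table_superalgebra B T) (coord 1 i) (coord 1 j) k =
      (\<Sum>p\<in>B 0 \<union> B 1. if p = i then (\<Sum>q\<in>B 0 \<union> B 1. if q = j then T p q k else 0) else 0)"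
    unfolding table_superalgebra_def by (auto simp: coord_def intro!: sum.cong)
  also have "\<dots> = T i j k" using assms by (simp only: sum.delta if_True)
  finally show "br (table_superalgebra B T) (coord 1 i) (coord 1 j) k = T i j k" .
qed

lemma sum_apply: "(\<Sum>i\<in>A. g i) x = (\<Sum>i\<in>A. g i x)"
  for g :: "'a \<Rightarrow> 'b \<Rightarrow> 'c::comm_monoid_add"
  by (induction A rule: infinite_finite_induct) simp_all

text \<open>
  Linearity over finite sums. It turns an isomorphism from a table superalgebra into a spanning family with
  the tabulated products.
\<close>

lemma table_iso_expansion:
  assumes iso: "superalgebra_iso (table_superalgebra B T) K \<chi>"
    and fin: "finite (B 0 \<union> B 1)"
    and c: "\<And>i. i \<notin> B 0 \<union> B 1 \<Longrightarrow> c i = 0"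
  shows "\<chi> c = (\<Sum>i\<in>B 0 \<union> B 1. scal K (c i) (\<chi> (coord 1 i)))"
proof -
  let ?C = "table_superalgebra B T"
  let ?X = "space_of ?C"
  have add: "\<chi> (u + w) = \<chi> u + \<chi> w" if "u \<in> ?X" "w \<in> ?X" for u w
    using iso that by (auto simp: superalgebra_iso_def)
  have zero: "\<chi> 0 = 0" using add[of 0 0] by (simp add: space_of_table)
  have coord: "\<chi> (coord (c i) i) = scal K (c i) (\<chi> (coord 1 i))" if "i \<in> B 0 \<union> B 1" for i
  proof -
    have "coord 1 i \<in> ?X" using that by (auto simp: space_of_table coord_def)
    moreover have "coord (c i) i = scal ?C (c i) (coord 1 i)"
      by (auto simp: table_superalgebra_def coord_def)
    ultimately show ?thesis using iso by (auto simp: superalgebra_iso_def)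
  qed
  have partial_sum: "\<chi> (\<Sum>i\<in>A. coord (c i) i) = (\<Sum>i\<in>A. scal K (c i) (\<chi> (coord 1 i)))"
    if "A \<subseteq> B 0 \<union> B 1" for A
    using finite_subset[OF that fin] that
  proof (induction A rule: finite_induct)
    case (insert i A)
    have "(\<Sum>i\<in>A. coord (c i) i) \<in> ?X"
      using insert.prems unfolding space_of_table
      by (auto simp: coord_def sum_apply intro!: sum.neutral)
    moreover have "coord (c i) i \<in> ?X" using insert.prems by (auto simp: space_of_table coord_def)
    ultimately have "\<chi> (coord (c i) i + (\<Sum>i\<in>A. coord (c i) i)) =
        scal K (c i) (\<chi> (coord 1 i)) + \<chi> (\<Sum>i\<in>A. coord (c i) i)"
      using insert.prems coord[of i] by (subst add) auto
    moreover have "\<chi> (\<Sum>i\<in>A. coord (c i) i) = (\<Sum>i\<in>A. scal K (c i) (\<chi> (coord 1 i)))"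
      using insert by simp
    ultimately show ?case by (simp only: sum.insert[OF insert.hyps])
  qed (simp add: zero)
  have "(\<Sum>i\<in>B 0 \<union> B 1. coord (c i) i) = c"
    using c fin by (auto simp: fun_eq_iff coord_def sum_apply sum.delta' simp del: Un_iff)
  then show ?thesis using partial_sum[OF subset_refl] by simp
qed

context leibniz_super
begin

lemma br_sum_left: "(\<And>i. i \<in> A \<Longrightarrow> g i \<in> S) \<Longrightarrow> z \<in> S \<Longrightarrow> (\<Sum>i\<in>A. g i) \<bullet> z = (\<Sum>i\<in>A. g i \<bullet> z)"
proof (induction A rule: infinite_finite_induct)
  case (insert i A)
  then show ?case using subspace_sum[OF subspace_S, of A g] by simp
qed simp_all

lemma br_sum_right: "(\<And>i. i \<in> A \<Longrightarrow> g i \<in> S) \<Longrightarrow> z \<in> S \<Longrightarrow> z \<bullet> (\<Sum>i\<in>A. g i) = (\<Sum>i\<in>A. z \<bullet> g i)"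
proof (induction A rule: infinite_finite_induct)
  case (insert i A)
  then show ?case using subspace_sum[OF subspace_S, of A g] by simp
qed simp_all

text \<open>
  The natural map sends a coordinate vector to the linear combination of the basis with these
  coefficients; the isomorphism wanted here goes in the opposite direction and is its inverse.
\<close>

lemma isomorphic_table_of_basis:
  fixes B :: "bit \<Rightarrow> 'i set"
  assumes fin: "finite (B 0 \<union> B 1)"
    and span: "\<And>a. part L a = span (b ` B a)"
    and indep: "\<And>c i. (\<Sum>i\<in>B 0 \<union> B 1. c i *\<^sub>L b i) = 0 \<Longrightarrow> i \<in> B 0 \<union> B 1 \<Longrightarrow> c i = 0"
    and supp: "\<And>i j k. i \<in> B 0 \<union> B 1 \<Longrightarrow> j \<in> B 0 \<union> B 1 \<Longrightarrow> k \<notin> B 0 \<union> B 1 \<Longrightarrow> T i j k = 0"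
    and table: "\<And>i j. i \<in> B 0 \<union> B 1 \<Longrightarrow> j \<in> B 0 \<union> B 1 \<Longrightarrow>
      b i \<bullet> b j = (\<Sum>k\<in>B 0 \<union> B 1. T i j k *\<^sub>L b k)"
  shows "superalgebra_isomorphic L (table_superalgebra B T)"
proof -
  let ?B = "B 0 \<union> B 1"
  let ?C = "table_superalgebra B T"
  define \<psi> where "\<psi> c = (\<Sum>i\<in>?B. c i *\<^sub>L b i)" for c
  have b_part: "b i \<in> part L a" if "i \<in> B a" for i a
    using that span by (auto intro: span_base)
  have b_S: "b i \<in> S" if "i \<in> ?B" for i using that b_part part_S by blast
  have add: "\<psi> (c + d) = \<psi> c + \<psi> d" for c d
    by (simp add: \<psi>_def scale_left_distrib sum.distrib)
  have scale: "\<psi> (\<lambda>i. r * c i) = r *\<^sub>L \<psi> c" for r c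
    by (simp add: \<psi>_def scale_sum_right)
  have \<psi>_S: "\<psi> c \<in> S" for c
    unfolding \<psi>_def using b_S by (intro subspace_sum subspace_S) simp
  have parts: "\<psi> ` part ?C a = part L a" for a
  proof
    show "\<psi> ` part ?C a \<subseteq> part L a"
    proof clarify
      fix c assume "c \<in> part ?C a"
      then have "c i = 0" if "i \<notin> B a" for i using that by (simp add: table_superalgebra_def)
      then have "c i *\<^sub>L b i \<in> part L a" for i using b_part[of i a] part_scale by (cases "i \<in> B a") auto
      then show "\<psi> c \<in> part L a" unfolding \<psi>_def by (intro subspace_sum subspace_part)
    qed
    have "subspace (\<psi> ` part ?C a)"
      unfolding subspace_def
    proof (intro conjI ballI allI)
      have "\<psi> 0 = 0" by (simp add: \<psi>_def)
      then show "0 \<in> \<psi> ` part ?C a" by (force simp: table_superalgebra_def)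
    next
      fix u w assume "u \<in> \<psi> ` part ?C a" "w \<in> \<psi> ` part ?C a"
      then obtain c d where "u = \<psi> c" "w = \<psi> d" "c \<in> part ?C a" "d \<in> part ?C a" by blast
      then show "u + w \<in> \<psi> ` part ?C a"
        by (intro image_eqI[of _ _ "c + d"]) (auto simp: add table_superalgebra_def)
    next
      fix r u assume "u \<in> \<psi> ` part ?C a"
      then obtain c where "u = \<psi> c" "c \<in> part ?C a" by blast
      then show "r *\<^sub>L u \<in> \<psi> ` part ?C a"
        by (intro image_eqI[of _ _ "\<lambda>i. r * c i"]) (auto simp: scale table_superalgebra_def)
    qed
    moreover have "b ` B a \<subseteq> \<psi> ` part ?C a"
    proof clarify
      fix i assume i: "i \<in> B a"
      then have "i \<in> ?B" by (cases a) auto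
      then have "b i = \<psi> (coord 1 i)"
        using fin by (simp add: \<psi>_def coord_def if_distrib[of "\<lambda>r. r *\<^sub>L _"] sum.delta cong: if_cong)
      then show "b i \<in> \<psi> ` part ?C a" using coord_in_table[of i B a, OF i] by blast
    qed
    ultimately show "part L a \<subseteq> \<psi> ` part ?C a" unfolding span by (intro span_minimal)
  qed
  have inj: "inj_on \<psi> (space_of ?C)"
  proof (rule inj_onI)
    fix c d assume cd: "c \<in> space_of ?C" "d \<in> space_of ?C" and eq: "\<psi> c = \<psi> d"
    have "(\<Sum>i\<in>?B. (c i - d i) *\<^sub>L b i) = 0"
      using eq by (simp add: \<psi>_def scale_left_diff_distrib sum_subtractf)
    then have "c i = d i" if "i \<in> ?B" for i using indep[of "\<lambda>i. c i - d i" i] that by simp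
    moreover have "c i = d i" if "i \<notin> ?B" for i using cd that unfolding space_of_table by simp
    ultimately show "c = d" by blast
  qed
  have surj: "\<psi> ` space_of ?C = S"
  proof
    show "\<psi> ` space_of ?C \<subseteq> S" using \<psi>_S by blast
    show "S \<subseteq> \<psi> ` space_of ?C"
    proof
      fix u assume "u \<in> S"
      then obtain u0 u1 where u: "u = u0 + u1" "u0 \<in> part L 0" "u1 \<in> part L 1"
        using S_decompose by blast
      obtain c where c: "c \<in> part ?C 0" "u0 = \<psi> c" using u(2) parts[of 0] by blast
      obtain d where d: "d \<in> part ?C 1" "u1 = \<psi> d" using u(3) parts[of 1] by blast
      have "u = \<psi> (c + d)" "c + d \<in> space_of ?C"
        using u c d by (simp add: add, auto simp: space_of_def)
      then show "u \<in> \<psi> ` space_of ?C" by blast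
    qed
  qed
  have br: "\<psi> (br ?C c d) = \<psi> c \<bullet> \<psi> d" for c d
  proof -
    have "\<psi> c \<bullet> \<psi> d = (\<Sum>i\<in>?B. \<Sum>j\<in>?B. (c i * d j) *\<^sub>L (b i \<bullet> b j))"
      using b_S \<psi>_S unfolding \<psi>_def[of c] \<psi>_def[of d]
      by (subst br_sum_left, simp, metis \<psi>_S \<psi>_def)
        (auto simp: br_sum_right scale_sum_right mult.commute subspace_sum[OF subspace_S] simp del: Un_iff intro!: sum.cong)
    also have "\<dots> = (\<Sum>i\<in>?B. \<Sum>j\<in>?B. \<Sum>k\<in>?B. (c i * d j * T i j k) *\<^sub>L b k)"
      using table by (simp add: scale_sum_right del: Un_iff)
    also have "\<dots> = (\<Sum>i\<in>?B. \<Sum>k\<in>?B. \<Sum>j\<in>?B. (c i * d j * T i j k) *\<^sub>L b k)"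
      by (intro sum.cong[OF refl] sum.swap)
    also have "\<dots> = (\<Sum>k\<in>?B. \<Sum>i\<in>?B. \<Sum>j\<in>?B. (c i * d j * T i j k) *\<^sub>L b k)"
      by (rule sum.swap)
    also have "\<dots> = \<psi> (br ?C c d)"
      by (simp add: \<psi>_def table_superalgebra_def scale_sum_left del: Un_iff)
    finally show ?thesis ..
  qed
  have "superalgebra_iso ?C L \<psi>"
    unfolding superalgebra_iso_def bij_betw_def
    using inj surj parts br add scale by (simp add: table_superalgebra_def)
  then have "superalgebra_iso L ?C (inv_into (space_of ?C) \<psi>)"
  proof (rule superalgebra_iso_sym)
    show "part ?C a \<subseteq> space_of ?C" for a
      unfolding space_of_table by (cases a) (auto simp: table_superalgebra_def)
    show "br ?C c d \<in> space_of ?C" for c d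
      unfolding space_of_table using supp
      by (auto simp: table_superalgebra_def intro!: sum.neutral)
  qed (auto simp: space_of_table, simp add: table_superalgebra_def)
  then show ?thesis unfolding superalgebra_isomorphic_def by blast
qed

end

section \<open>Two generators of the nilradical\<close>

abbreviation M_basis :: "nat \<Rightarrow> bit \<Rightarrow> gen set" where
  "M_basis n \<equiv> \<lambda>a. if a = 0 then Eg ` {1..n} else Yg ` {1..n}"

context leibniz_super
begin

text \<open>
  The generators are \<open>y = y\<^sub>1\<close> and \<open>f = e\<^sub>2\<close>. Two right multiplications by \<open>y\<close> lead from \<open>y\<^sub>i\<close> to half of
  \<open>y\<^bsub>i+1\<^esub>\<close>, so the odd powers of \<open>y\<close> are \<open>2\<^bsup>-i\<^esup> y\<^bsub>i+1\<^esub>\<close> and the even ones \<open>2\<^bsup>-i\<^esup> e\<^bsub>i+2\<^esub>\<close>, except that the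
  square of \<open>y\<close> is \<open>e\<^sub>1\<close>.
\<close>

lemma filiform_radical_of_M:
  assumes n: "n \<ge> 3"
    and ideal: "graded_ideal L N" and derived: "product_space L S S \<subseteq> N"
    and isom: "superalgebra_isomorphic (restrict_to L N) (M_superalgebra n)"
  obtains y f where "filiform_radical L y f (2 * n - 1)" "flag y f 1 = N"
proof -
  let ?K = "restrict_to L N"
  let ?B = "M_basis n 0 \<union> M_basis n 1"
  let ?C = "table_superalgebra (M_basis n) (M_table n)"
  have K [simp]: "scal ?K = scal L" "br ?K = br L" "part ?K a = N \<inter> part L a" for a
    by (simp_all add: restrict_to_def)
  have N: "subspace N" "space_of ?K = N" "\<And>u w. u \<in> N \<Longrightarrow> w \<in> S \<Longrightarrow> u \<bullet> w \<in> N"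
    using ideal by (auto simp: graded_ideal_def)
  have NS: "u \<in> S" if "u \<in> N" for u
  proof -
    have "u \<in> space_of ?K" using that N by simp
    then show ?thesis by (auto simp: space_of_def)
  qed
  obtain \<phi> where "superalgebra_iso ?K ?C \<phi>"
    using isom unfolding superalgebra_isomorphic_def M_superalgebra_def by blast
  then have "superalgebra_iso ?C ?K (inv_into (space_of ?K) \<phi>)"
    by (rule superalgebra_iso_sym)
      (use N NS in \<open>auto intro: subspace_add subspace_scale\<close>)
  then obtain \<chi> where \<chi>: "superalgebra_iso ?C ?K \<chi>" by blast
  have fin: "finite ?B" by simp
  define b where "b i = \<chi> (coord 1 i)" for i
  have expand: "\<chi> c = (\<Sum>i\<in>?B. c i *\<^sub>L b i)" if "\<And>i. i \<notin> ?B \<Longrightarrow> c i = 0" for c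
    using table_iso_expansion[OF \<chi> fin that] by (simp add: b_def)
  have coord: "\<chi> (coord r i) = r *\<^sub>L b i" if "i \<in> ?B" for r i
    using that by (subst expand) (auto simp: coord_def if_distrib[of "\<lambda>r. r *\<^sub>L _"] cong: if_cong simp del: Un_iff)
  have zero: "\<chi> 0 = 0" by (subst expand) auto
  have mem: "coord 1 i \<in> space_of ?C" if "i \<in> ?B" for i
    unfolding space_of_table using that by (auto simp: coord_def)
  have bij: "bij_betw \<chi> (space_of ?C) N" using \<chi> N by (simp add: superalgebra_iso_def)
  have b_N: "b i \<in> N" if "i \<in> ?B" for i
    using mem[OF that] bij by (auto simp: b_def bij_betw_def)
  have b_part: "b i \<in> part L a" if "i \<in> M_basis n a" for i a
  proof -
    have "coord 1 i \<in> part ?C a" using coord_in_table that .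
    moreover have "\<chi> ` part ?C a = N \<inter> part L a" using \<chi> by (simp add: superalgebra_iso_def)
    ultimately show ?thesis by (auto simp: b_def)
  qed
  have hom: "\<chi> (br ?C c d) = \<chi> c \<bullet> \<chi> d" if "c \<in> space_of ?C" "d \<in> space_of ?C" for c d
    using \<chi> that by (simp add: superalgebra_iso_def)
  have b_br: "b i \<bullet> b j = \<chi> (M_table n i j)" if "i \<in> ?B" "j \<in> ?B" for i j
    using hom[OF mem[OF that(1)] mem[OF that(2)]] br_table_coord[OF fin that, of "M_table n"]
    by (simp add: b_def)
  have b_nonzero: "b i \<noteq> 0" if "i \<in> ?B" for i
  proof
    assume "b i = 0"
    then have "\<chi> (coord 1 i) = \<chi> 0" by (simp add: b_def zero)
    moreover have "0 \<in> space_of ?C" by (simp add: space_of_table)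
    ultimately have "coord 1 i = (0 :: gen \<Rightarrow> complex)"
      using bij mem[OF that] by (auto simp: bij_betw_def dest: inj_onD)
    then have "coord 1 i i = (0 :: complex)" by (simp only: zero_fun_apply)
    then show False by (simp add: coord_def)
  qed
  have N_span: "N \<subseteq> span (b ` ?B)"
  proof
    fix u assume "u \<in> N"
    then obtain c where "c \<in> space_of ?C" "u = \<chi> c" using bij by (auto simp: bij_betw_def)
    then have "u = (\<Sum>i\<in>?B. c i *\<^sub>L b i)"
      using expand[of c] unfolding space_of_table by blast
    then show "u \<in> span (b ` ?B)"
      by (simp only:) (intro span_sum span_scale span_base imageI)
  qed
  define y where "y = b (Yg 1)"
  define f where "f = b (Eg 2)"
  have B: "Eg i \<in> ?B \<longleftrightarrow> 1 \<le> i \<and> i \<le> n" "Yg i \<in> ?B \<longleftrightarrow> 1 \<le> i \<and> i \<le> n" for i by auto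
  have y: "y \<in> part L 1" "y \<in> N" "y \<in> S" and f: "f \<in> part L 0" "f \<in> N" "f \<in> S"
    using n b_part[of "Yg 1" 1] b_N[of "Yg 1"] b_part[of "Eg 2" 0] b_N[of "Eg 2"] NS
    by (auto simp: y_def f_def)
  have b_S: "b i \<in> S" if "i \<in> ?B" for i using b_N[OF that] NS by blast
  have E_y: "b (Eg i) \<bullet> y = (1/2) *\<^sub>L b (Yg i)" if "2 \<le> i" "i \<le> n" for i
    using that b_br[of "Eg i" "Yg 1"] coord[of "Yg i"] by (simp add: y_def)
  have Y_y: "b (Yg i) \<bullet> y = (if i = n then 0 else b (Eg (i + 1)))" if "2 \<le> i" "i \<le> n" for i
    using that b_br[of "Yg i" "Yg 1"] coord[of "Eg (i + 1)"] zero by (auto simp: y_def)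
  have y_y: "y \<bullet> y = b (Eg 1)" and e1_y: "b (Eg 1) \<bullet> y = (1/2) *\<^sub>L b (Yg 2)"
    using n b_br[of "Yg 1" "Yg 1"] coord[of "Eg 1"] b_br[of "Eg 1" "Yg 1"] coord[of "Yg 2"]
    by (auto simp: y_def)
  have r2: "rpow y 2 = b (Eg 1)" using y_y rpow_Suc[of 1 y] by (simp add: numeral_2_eq_2)
  have r_even: "rpow y (2 * i + 2) = (if i + 1 = n then 0 else (1/2)^i *\<^sub>L b (Eg (i + 2)))"
    if "rpow y (2 * i + 1) = (1/2)^i *\<^sub>L b (Yg (i + 1))" "i \<ge> 1" "i < n" for i
    using that rpow_Suc[of "2 * i + 1" y] Y_y[of "i + 1"] b_S[of "Yg (i + 1)"] y by auto
  have r_odd: "rpow y (2 * i + 1) = (1/2)^i *\<^sub>L b (Yg (i + 1))" if "i < n" for i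
    using that
  proof (induction i)
    case 0
    then show ?case by (simp add: y_def)
  next
    case (Suc i)
    have "rpow y (2 * Suc i + 1) = rpow y (2 * i + 2) \<bullet> y"
      using rpow_Suc[of "2 * i + 2" y] by (simp add: numeral_3_eq_3)
    also have "\<dots> = (1/2) ^ Suc i *\<^sub>L b (Yg (Suc i + 1))"
    proof (cases "i = 0")
      case True
      then show ?thesis using r2 e1_y by (simp add: numeral_2_eq_2)
    next
      case False
      then show ?thesis
        using Suc r_even[of i] E_y[of "i + 2"] b_S[of "Eg (i + 2)"] y by simp
    qed
    finally show ?case .
  qed
  have r3: "rpow y 3 = (1/2) *\<^sub>L b (Yg 2)" using r_odd[of 1] n by (simp add: numeral_2_eq_2 numeral_3_eq_3)
  have r_N: "rpow y k \<in> N" for k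
  proof (induction k)
    case (Suc k)
    then show ?case using rpow_Suc[of k y] N(3) y by (cases "k = 0") auto
  qed (use y in \<open>simp add: rpow_def\<close>)
  have flag_N: "flag y f 1 = N"
  proof
    show "flag y f 1 \<subseteq> N"
      unfolding flag_def flag_gens_def using r_N f by (intro span_minimal N(1)) auto
    have "b i \<in> flag y f 1" if i: "i \<in> ?B" for i
    proof -
      have sc: "u \<in> flag y f 1 \<Longrightarrow> r *\<^sub>L u \<in> flag y f 1" for r u
        unfolding flag_def by (rule span_scale)
      consider j where "i = Yg j" "1 \<le> j" "j \<le> n" | "i = Eg 1" | "i = Eg 2"
        | j where "i = Eg j" "3 \<le> j" "j \<le> n"
        using i by (fastforce simp: numeral_3_eq_3 numeral_2_eq_2 le_Suc_eq not_less_eq_eq)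
      then show ?thesis
      proof cases
        case 1
        have "b i = 2 ^ (j - 1) *\<^sub>L rpow y (2 * (j - 1) + 1)"
          using 1 r_odd[of "j - 1"] by (simp flip: power_mult_distrib)
        then show ?thesis using rpow_flag[of 1 "2 * (j - 1) + 1" y f] sc by simp
      next
        case 2
        then show ?thesis using r2 rpow_flag[of 1 2 y f] by simp
      next
        case 3
        then show ?thesis using generator_flag[of 1 f y] by (simp add: f_def)
      next
        case 4
        then obtain l where l: "j = l + 2" "1 \<le> l" "l + 2 \<le> n"
          using that[of "j - 2"] by simp
        then have "rpow y (2 * l + 2) = (1/2) ^ l *\<^sub>L b (Eg (l + 2))"
          using r_even[OF r_odd, of l] by simp
        then have "b i = 2 ^ l *\<^sub>L rpow y (2 * l + 2)"
          using 4 l by (simp flip: power_mult_distrib)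
        then show ?thesis using rpow_flag[of 1 "2 * l + 2" y f] sc by simp
      qed
    qed
    then have "span (b ` ?B) \<subseteq> flag y f 1"
      unfolding flag_def by (intro span_minimal) auto
    then show "N \<subseteq> flag y f 1" using N_span by blast
  qed
  have "filiform_radical L y f (2 * n - 1)"
  proof
    show "y \<in> part L 1" "f \<in> part L 0" "2 * n - 1 \<ge> 3" using y f n by auto
    show "f \<bullet> y = rpow y 3" using E_y[of 2] n r3 by (simp add: f_def)
    show "rpow y (2 * n - 1) \<noteq> 0"
    proof -
      have "2 * n - 1 = 2 * (n - 1) + 1" using n by simp
      then show ?thesis using r_odd[of "n - 1"] n b_nonzero[of "Yg n"] by simp
    qed
    show "rpow y (Suc (2 * n - 1)) = 0"
    proof -
      have "Suc (2 * n - 1) = 2 * (n - 1) + 2" using n by simp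
      then show ?thesis using r_even[OF r_odd, of "n - 1"] n by simp
    qed
    show "u \<bullet> w \<in> flag y f 1" if "u \<in> S" "w \<in> S" for u w
      using derived that unfolding flag_N product_space_def by (auto intro: span_base)
    show "u \<bullet> f = 0" if u: "u \<in> flag y f 1" for u
    proof -
      have "u \<in> span (b ` ?B)" using u N_span flag_N by blast
      then have "u \<bullet> f \<in> {0}"
      proof (rule br_span_left)
        show "h \<bullet> f \<in> {0}" if "h \<in> b ` ?B" for h
          using that b_br[of _ "Eg 2"] zero n unfolding f_def by fastforce
        show "b ` ?B \<subseteq> S" using b_S by blast
      qed (use f in simp_all)
      then show ?thesis by simp
    qed
  qed
  with flag_N show thesis using that by blast
qed

end

section \<open>Recognizing the extension from its basis\<close>

abbreviation SM_basis :: "nat \<Rightarrow> bit \<Rightarrow> gen set" where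
  "SM_basis n \<equiv> \<lambda>a. if a = 0 then insert Xg (Eg ` {1..n}) else Yg ` {1..n}"

text \<open>
  The eigenvalue of right multiplication by \<open>x\<close>; the even generators of indices \<open>1\<close> and \<open>2\<close> share it.
\<close>

fun weight :: "gen \<Rightarrow> nat" where
  "weight Xg = 0"
| "weight (Yg i) = 2 * i - 1"
| "weight (Eg i) = (if i = 1 then 2 else 2 * i - 2)"

text \<open>
  The situation after all normalizations: a radical of the dimension of \<open>M(0,\<dots>,0)\<close> with generators
  that are eigenvectors of right multiplication by \<open>x\<close>, and a complement spanned by \<open>x\<close>.
\<close>

locale diagonal_extension = filiform_radical L y f m
  for L :: "'v::ab_group_add superalgebra" and y f m +
  fixes n :: nat and x :: 'v
  assumes m: "m = 2 * n - 1" and n: "n \<ge> 3"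
    and x: "x \<in> part L 0" "x \<notin> flag y f 1" "\<And>w. w \<in> space_of L \<Longrightarrow> \<exists>c. w - scal L c x \<in> flag y f 1"
    and yx: "br L y x = y" and fx: "br L f x = scal L 2 f"
    and xx: "br L x x = 0" and xf: "br L x f = 0" and xy: "br L x y = - y"
begin

abbreviation gens where "gens \<equiv> SM_basis n 0 \<union> SM_basis n 1"

text \<open>
  The powers of two turn the chain of powers of \<open>y\<close> into the basis vectors of \<open>SM\<close>.
\<close>

fun basis :: "gen \<Rightarrow> 'v" where
  "basis Xg = x"
| "basis (Yg i) = 2 ^ (i - 1) *\<^sub>L v (2 * i - 1)"
| "basis (Eg i) =
     (if i = 1 then v 2 else if i = 2 then f else 2 ^ (i - 2) *\<^sub>L v (2 * i - 2))"

declare basis.simps [simp del]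

lemma basis_X: "basis Xg = x"
  and basis_E1: "basis (Eg 1) = v 2" "basis (Eg (Suc 0)) = v 2"
  and basis_E2: "basis (Eg 2) = f"
  and basis_E: "i \<ge> 3 \<Longrightarrow> basis (Eg i) = 2 ^ (i - 2) *\<^sub>L v (2 * i - 2)"
  and basis_Y: "basis (Yg i) = 2 ^ (i - 1) *\<^sub>L v (2 * i - 1)"
  by (simp_all add: basis.simps)

lemma xS [simp]: "x \<in> S"
  using x part_S by blast

lemma gens_cases [consumes 1]:
  assumes "i \<in> gens"
  obtains (X) "i = Xg" | (E1) "i = Eg 1" | (E2) "i = Eg 2"
    | (E) j where "i = Eg j" "3 \<le> j" "j \<le> n"
    | (Y) j where "i = Yg j" "1 \<le> j" "j \<le> n"
proof (cases i)
  case (Eg j)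
  then have "1 \<le> j" "j \<le> n" using assms by auto
  then show ?thesis using that(2-4) Eg by (cases "j = 1 \<or> j = 2") auto
qed (use that assms in auto)

lemma v_even: "v j \<in> part L 0" if "even j" "j \<ge> 1" for j
  using v_part[OF that(2)] that(1) by (auto elim!: evenE)

lemma v_odd: "v j \<in> part L 1" if "odd j" for j
  using v_part[of j] that by (auto elim!: oddE)

lemma basis_part: "basis i \<in> part L a" if "i \<in> SM_basis n a" for i a
proof -
  have "i \<in> gens" using that by (cases a) auto
  then show ?thesis
  proof (cases rule: gens_cases)
    case X
    then show ?thesis using that x by (auto simp: basis_X split: if_splits)
  next
    case E1
    then show ?thesis using that v_even[of 2] basis_E1 by (auto split: if_splits)
  next
    case E2
    then show ?thesis using that f_even basis_E2 by (auto split: if_splits)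
  next
    case (E j)
    then show ?thesis using that v_even[of "2 * j - 2"] by (auto simp: basis_E part_scale split: if_splits)
  next
    case (Y j)
    then show ?thesis using that v_odd[of "2 * j - 1"] by (auto simp: basis_Y part_scale split: if_splits)
  qed
qed

lemma rpow_in_span_basis: "v j \<in> span (basis ` SM_basis n a)" if "v j \<in> part L a" "j \<ge> 1" for j a
proof (cases "j \<le> m")
  case False
  then show ?thesis using v_beyond[of j] by (simp add: span_zero)
next
  case True
  then have nz: "v j \<noteq> 0" using v_nonzero that by simp
  show ?thesis
  proof (cases "even j")
    case True
    then have a: "a = 0" using parts_meet[OF that(1) v_even] nz that(2) by blast
    define i where "i = j div 2 + 1"
    have i: "j = 2 * i - 2" "i \<ge> 2" "i \<le> n" using True \<open>j \<le> m\<close> that(2) m by (auto simp: i_def elim!: evenE)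
    show ?thesis
    proof (cases "i = 2")
      case True
      then have "v j = basis (Eg 1)" using i basis_E1 by simp
      then show ?thesis using n a by (auto intro: span_base)
    next
      case False
      then have "v j = inverse (2 ^ (i - 2)) *\<^sub>L basis (Eg i)" using i basis_E[of i] by simp
      moreover have "basis (Eg i) \<in> span (basis ` SM_basis n a)" using i a by (auto intro: span_base)
      ultimately show ?thesis by (simp only: span_scale)
    qed
  next
    case False
    then have a: "a = 1" using parts_meet[OF that(1) v_odd] nz by blast
    define i where "i = j div 2 + 1"
    have i: "j = 2 * i - 1" "i \<ge> 1" "i \<le> n" using False \<open>j \<le> m\<close> m n by (auto simp: i_def elim!: oddE)
    have "v j = inverse (2 ^ (i - 1)) *\<^sub>L basis (Yg i)" using i basis_Y[of i] by simp
    moreover have "basis (Yg i) \<in> span (basis ` SM_basis n a)" using i a by (auto intro: span_base)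
    ultimately show ?thesis by (simp only: span_scale)
  qed
qed

lemma radical_in_span_basis: "u \<in> span (basis ` SM_basis n a)" if "u \<in> G 1" "u \<in> part L a" for u a
proof -
  have "u \<in> span (flag_gens y f 1 \<inter> part L a)"
    using that gens_homogeneous[of 1] unfolding flag_def by (intro span_homogeneous_part) auto
  moreover have "flag_gens y f 1 \<inter> part L a \<subseteq> span (basis ` SM_basis n a)"
  proof
    fix h assume h: "h \<in> flag_gens y f 1 \<inter> part L a"
    then consider j where "j \<ge> 1" "h = v j" | "h = f" by (auto simp: flag_gens_def)
    then show "h \<in> span (basis ` SM_basis n a)"
    proof cases
      case 2
      have f: "basis (Eg 2) = f" "Eg 2 \<in> SM_basis n 0" using n basis_E2 by auto
      show ?thesis
      proof (cases "a = 0")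
        case True
        then have "basis (Eg 2) \<in> span (basis ` SM_basis n a)" using f(2) by (intro span_base imageI) simp
        then show ?thesis using 2 f(1) by simp
      next
        case False
        then have "f = 0" using parts_meet[of f 0 a] f_even h 2 by auto
        then show ?thesis using 2 by (simp add: span_zero)
      qed
    qed (use rpow_in_span_basis h in auto)
  qed
  ultimately show ?thesis using span_minimal by blast
qed

text \<open>
  For odd \<open>u\<close> the product \<open>[y,u]\<close> has weight at least \<open>2\<close>, whereas \<open>[y,x] = y\<close>; this excludes a component
  of \<open>u\<close> along \<open>x\<close>.
\<close>

lemma span_basis: "part L a = span (basis ` SM_basis n a)" for a
proof
  show "span (basis ` SM_basis n a) \<subseteq> part L a"
    using basis_part by (intro span_minimal subspace_part) blast
  show "part L a \<subseteq> span (basis ` SM_basis n a)"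
  proof
    fix u assume u: "u \<in> part L a"
    then obtain c where c: "u - c *\<^sub>L x \<in> G 1" using x(3) part_S by blast
    show "u \<in> span (basis ` SM_basis n a)"
    proof (cases "a = 0")
      case True
      then have "u - c *\<^sub>L x \<in> part L a" using u x(1) by (simp add: part_diff part_scale)
      then have "u - c *\<^sub>L x \<in> span (basis ` SM_basis n a)" by (rule radical_in_span_basis[OF c])
      moreover have "c *\<^sub>L x \<in> span (basis ` SM_basis n a)"
        using True basis_X by (intro span_scale span_base) (auto simp: image_iff)
      ultimately have "(u - c *\<^sub>L x) + c *\<^sub>L x \<in> span (basis ` SM_basis n a)" by (rule span_add)
      then show ?thesis by simp
    next
      case False
      then have a: "a = 1" by simp
      then have "y \<bullet> u \<in> G 2" "y \<bullet> (u - c *\<^sub>L x) \<in> G 2"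
        using odd_positive[of u] G1_positive[OF c] u by (simp_all add: positive_part_def)
      then have "y \<bullet> u - y \<bullet> (u - c *\<^sub>L x) \<in> G 2" by (rule G_diff)
      then have "c *\<^sub>L y \<in> G 2" using u part_S[OF u] yx by simp
      then have "c = 0" using v_strict[of c 1] m_ge_3 by (simp add: numeral_2_eq_2)
      then show ?thesis using radical_in_span_basis u c by simp
    qed
  qed
qed

lemma basis_weight: "basis i \<in> G (weight i)" if "i \<in> gens" "i \<noteq> Xg" for i
  using that(1)
proof (cases rule: gens_cases)
  case E1
  then show ?thesis using v_G[of 2 2] basis_E1 by simp
next
  case E2
  then show ?thesis using f_G[of 2] basis_E2 by simp
next
  case (E j)
  then show ?thesis by (simp add: basis_E G_scale v_G)
next
  case (Y j)
  then show ?thesis by (simp add: basis_Y G_scale v_G)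
qed (use that in simp)

lemma weight_inj: "j = i"
  if i: "i \<in> gens" "i \<noteq> Eg 1" "i \<noteq> Eg 2" and j: "j \<in> gens" and eq: "weight j = weight i" for i j
  using i(1)
proof (cases rule: gens_cases)
  case X
  from j show ?thesis by (cases rule: gens_cases) (use X eq in auto)
next
  case (E p)
  from j show ?thesis
  proof (cases rule: gens_cases)
    case (Y q)
    then have "2 * q - 1 = 2 * p - 2" "q \<ge> 1" using E eq by auto
    then have False using E(2) by presburger
    then show ?thesis ..
  qed (use E eq in auto)
next
  case (Y p)
  from j show ?thesis
  proof (cases rule: gens_cases)
    case (E q)
    then have "2 * q - 2 = 2 * p - 1" "q \<ge> 3" using Y eq by auto
    then have False using Y(2) by presburger
    then show ?thesis ..
  next
    case E1
    then have "2 = 2 * p - 1" using Y eq by auto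
    then have False by presburger
    then show ?thesis ..
  next
    case E2
    then have "2 = 2 * p - 1" using Y eq by auto
    then have False by presburger
    then show ?thesis ..
  qed (use Y eq in auto)
qed (use i in simp_all)

lemma weight_two: "j = Eg 1 \<or> j = Eg 2" if j: "j \<in> gens" and eq: "weight j = 2" for j
  using weight_inj[of j "Eg 1"] that n by auto

text \<open>
  Induction on the weight: a relation without terms of weight below \<open>k\<close> forces the part of weight \<open>k\<close>
  into higher weights. That part is a multiple of one generator, except in weight \<open>2\<close>, where the two
  generators are independent modulo weight \<open>3\<close>.
\<close>

lemma basis_independent: "c i = 0" if zero: "(\<Sum>i\<in>gens. c i *\<^sub>L basis i) = 0" and i: "i \<in> gens" for c i
  using i
proof (induction "weight i" arbitrary: i rule: less_induct)
  case less
  let ?k = "weight i"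
  define H where "H = {j \<in> gens. weight j = ?k}"
  have fin: "finite gens" by simp
  have H: "H \<subseteq> gens" "finite H" by (auto simp: H_def)
  have "(\<Sum>j\<in>H. c j *\<^sub>L basis j) = - (\<Sum>j\<in>gens - H. c j *\<^sub>L basis j)"
    using zero sum.subset_diff[OF H(1) fin, of "\<lambda>j. c j *\<^sub>L basis j"]
    by (simp add: eq_neg_iff_add_eq_0 add.commute)
  moreover have "(\<Sum>j\<in>gens - H. c j *\<^sub>L basis j) \<in> G (Suc ?k)"
  proof (rule subspace_sum[OF subspace_G])
    fix j assume j: "j \<in> gens - H"
    show "c j *\<^sub>L basis j \<in> G (Suc ?k)"
    proof (cases "weight j < ?k")
      case True
      then have "c j = 0" using less.hyps[of j] j by blast
      then show ?thesis by simp
    next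
      case False
      then have "Suc ?k \<le> weight j" using j by (auto simp: H_def)
      moreover from this have "j \<noteq> Xg" by auto
      ultimately have "basis j \<in> G (Suc ?k)" using basis_weight[of j] G_mono j by blast
      then show ?thesis by (rule G_scale)
    qed
  qed
  ultimately have top: "(\<Sum>j\<in>H. c j *\<^sub>L basis j) \<in> G (Suc ?k)"
    by (simp only: G_neg)
  have single: "c i *\<^sub>L basis i \<in> G (Suc ?k)" if "i \<noteq> Eg 1" "i \<noteq> Eg 2"
  proof -
    have "H = {i}" using weight_inj[OF less.prems that] less.prems unfolding H_def by blast
    then show ?thesis using top by simp
  qed
  from less.prems show ?case
  proof (cases rule: gens_cases)
    case X
    then have "c i *\<^sub>L x \<in> G 1" using single X basis_X by simp
    then show ?thesis using x(2) G_scale[of "c i *\<^sub>L x" 1 "inverse (c i)"] by (cases "c i = 0") auto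
  next
    case E1
    then have "H = {Eg 1, Eg 2}" using n weight_two unfolding H_def by auto
    then have "c (Eg 2) *\<^sub>L f + c (Eg 1) *\<^sub>L v 2 \<in> G 3"
      using top E1 basis_E1 basis_E2 by (simp add: add.commute numeral_3_eq_3)
    then show ?thesis using degree_two_strict(2) E1 by simp
  next
    case E2
    then have "H = {Eg 1, Eg 2}" using n weight_two unfolding H_def by auto
    then have "c (Eg 2) *\<^sub>L f + c (Eg 1) *\<^sub>L v 2 \<in> G 3"
      using top E2 basis_E1 basis_E2 by (simp add: add.commute numeral_3_eq_3)
    then show ?thesis using degree_two_strict(1) E2 by simp
  next
    case (E j)
    then have "(c i * 2 ^ (j - 2)) *\<^sub>L v (2 * j - 2) \<in> G (Suc (2 * j - 2))"
      using single E basis_E[of j] by simp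
    then have "c i * 2 ^ (j - 2) = 0" by (rule v_strict) (use E m in auto)
    then show ?thesis by simp
  next
    case (Y j)
    then have "(c i * 2 ^ (j - 1)) *\<^sub>L v (2 * j - 1) \<in> G (Suc (2 * j - 1))"
      using single Y basis_Y[of j] by simp
    then have "c i * 2 ^ (j - 1) = 0" by (rule v_strict) (use Y m in auto)
    then show ?thesis by simp
  qed
qed

definition lincomb :: "(gen \<Rightarrow> complex) \<Rightarrow> 'v" where
  "lincomb t = (\<Sum>k\<in>gens. t k *\<^sub>L basis k)"

lemma lincomb_coord: "lincomb (coord r i) = r *\<^sub>L basis i" if "i \<in> gens" for r i
  using that by (simp add: lincomb_def coord_def if_distrib[of "\<lambda>r. r *\<^sub>L _"] cong: if_cong del: Un_iff)

lemma lincomb_0: "lincomb 0 = 0" by (simp add: lincomb_def)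

lemma gens_iff: "Xg \<in> gens" "\<And>i. Eg i \<in> gens \<longleftrightarrow> 1 \<le> i \<and> i \<le> n" "\<And>i. Yg i \<in> gens \<longleftrightarrow> 1 \<le> i \<and> i \<le> n"
  by auto

lemma basis_S [simp]: "basis i \<in> S" if "i \<in> gens" for i
  using that basis_part[of i 0] basis_part[of i 1] part_S by blast

lemma rpow_top: "v (2 * n) = 0" using v_beyond m n by simp

lemma basis_times_y: "basis i \<bullet> y = lincomb (SM_table n i (Yg 1))" if "i \<in> gens" for i
  using that
proof (cases rule: gens_cases)
  case X
  then show ?thesis using n by (simp add: basis_X xy lincomb_coord gens_iff basis_Y)
next
  case E1
  then show ?thesis using n by (simp add: basis_E1 v2_y lincomb_coord gens_iff basis_Y)
next
  case E2
  then show ?thesis using n by (simp add: basis_E2 f_y lincomb_coord gens_iff basis_Y)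
next
  case (E j)
  then have "j - 1 = Suc (j - 2)" by simp
  then have "2 ^ (j - 1) = 2 * (2 :: complex) ^ (j - 2)" by (simp only: power_Suc)
  moreover have "Suc (2 * j - 2) = 2 * j - 1" using E by simp
  ultimately show ?thesis using E by (simp add: basis_E basis_Y v_Suc lincomb_coord gens_iff)
next
  case (Y j)
  then have "Suc (2 * j - Suc 0) = 2 * j" by simp
  then have "basis i \<bullet> y = 2 ^ (j - 1) *\<^sub>L v (2 * j)" using Y v_Suc[of "2 * j - 1"] by (simp add: basis_Y)
  then show ?thesis using Y n rpow_top basis_E[of "j + 1"]
    by (cases "j = 1"; cases "j = n") (auto simp: basis_E1 lincomb_coord lincomb_0 gens_iff)
qed

lemma basis_times_v2: "basis i \<bullet> v 2 = lincomb (SM_table n i (Eg 1))" if "i \<in> gens" for i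
  using that
proof (cases rule: gens_cases)
  case X
  then show ?thesis using n by (simp add: basis_X basis_E1 br_v2 xy lincomb_coord gens_iff y_y)
next
  case E1
  then show ?thesis using n v_Suc[of 3] by (simp add: basis_E1 br_v2 v2_y lincomb_coord gens_iff basis_E)
next
  case E2
  have "2 \<le> n - 1" using n by simp
  then show ?thesis using E2 n v_Suc[of 3] by (simp add: basis_E2 br_v2 f_y lincomb_coord gens_iff basis_E)
next
  case (E j)
  then have "Suc (Suc (2 * j - 2)) = 2 * j" by simp
  then have "basis i \<bullet> v 2 = (2 * 2 ^ (j - 2)) *\<^sub>L v (2 * j)"
    using E v_Suc[of "2 * j - 2"] v_Suc[of "Suc (2 * j - 2)"] by (simp add: basis_E br_v2)
  moreover have "j - 1 = Suc (j - 2)" using E by simp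
  then have "2 ^ (j - 1) = 2 * (2 :: complex) ^ (j - 2)" by (simp only: power_Suc)
  ultimately show ?thesis using E n rpow_top basis_E[of "j + 1"]
    by (cases "j = n") (auto simp: lincomb_coord lincomb_0 gens_iff)
next
  case (Y j)
  then have "Suc (2 * j - 1) = 2 * j" by simp
  then have "basis i \<bullet> v 2 = (2 * 2 ^ (j - 1)) *\<^sub>L v (2 * j + 1)"
    using Y v_Suc[of "2 * j - 1"] v_Suc[of "2 * j"] by (simp add: basis_Y br_v2)
  moreover have "j = Suc (j - 1)" using Y by simp
  then have "2 ^ j = 2 * (2 :: complex) ^ (j - 1)" by (metis power_Suc)
  moreover have "v (2 * n + 1) = 0" using v_beyond m by simp
  ultimately show ?thesis using Y n basis_Y[of "j + 1"]
    by (cases "j = n") (auto simp: lincomb_coord lincomb_0 gens_iff)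
qed

lemma basis_times_x: "basis i \<bullet> x = lincomb (SM_table n i Xg)" if "i \<in> gens" for i
  using that
proof (cases rule: gens_cases)
  case X
  then show ?thesis by (simp add: basis_X xx lincomb_0)
next
  case E1
  then show ?thesis using n rpow_eigen[OF x(1) yx, of 2] by (simp add: basis_E1 lincomb_coord gens_iff)
next
  case E2
  then show ?thesis using n by (simp add: basis_E2 fx lincomb_coord gens_iff)
next
  case (E j)
  then have "v (2 * j - 2) \<bullet> x = (2 * (of_nat j - 1)) *\<^sub>L v (2 * j - 2)"
    using rpow_eigen[OF x(1) yx, of "2 * j - 2"] by (simp add: of_nat_diff algebra_simps)
  then show ?thesis using E by (simp add: basis_E lincomb_coord gens_iff mult.commute)
next
  case (Y j)
  then have "v (2 * j - 1) \<bullet> x = (2 * of_nat j - 1) *\<^sub>L v (2 * j - 1)"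
    using rpow_eigen[OF x(1) yx, of "2 * j - 1"] by (simp add: of_nat_diff)
  then show ?thesis using Y by (simp add: basis_Y lincomb_coord gens_iff mult.commute)
qed

text \<open>
  All other basis vectors are \<open>f\<close> or of weight at least \<open>3\<close> and annihilate from the right.
\<close>

lemma basis_times_other: "basis i \<bullet> basis j = lincomb (SM_table n i j)"
  if "i \<in> gens" "j \<in> gens" "j \<noteq> Xg" "j \<noteq> Eg 1" "j \<noteq> Yg 1" for i j
proof -
  have "basis i \<bullet> basis j = 0"
  proof (cases "j = Eg 2")
    case True
    show ?thesis
    proof (cases "i = Xg")
      case False
      from that(1) have "weight i \<ge> 1" by (cases rule: gens_cases) (use False in auto)
      then have "basis i \<in> G 1" using basis_weight[OF that(1) False] G_mono by blast
      then show ?thesis using \<open>j = Eg 2\<close> radical_f by (simp add: basis_E2)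
    qed (use True basis_X xf basis_E2 in simp)
  next
    case False
    from that(2) have "weight j \<ge> 3" by (cases rule: gens_cases) (use that(3-5) False in auto)
    then show ?thesis using br_G3[of "basis j" "basis i"] basis_weight[of j] G_mono[of 3 "weight j"] that by auto
  qed
  moreover have "SM_table n i j = 0" using that(3-5) by (cases i; cases j) auto
  ultimately show ?thesis by (simp add: lincomb_0)
qed

lemma isomorphic_SM: "superalgebra_isomorphic L (SM_superalgebra n)"
  unfolding SM_superalgebra_def
proof (rule isomorphic_table_of_basis[where b = basis])
  show "SM_table n i j k = 0" if "i \<in> gens" "j \<in> gens" "k \<notin> gens" for i j k
    using that n by (cases i; cases j) (auto simp: coord_def)
  show "basis i \<bullet> basis j = (\<Sum>k\<in>gens. SM_table n i j k *\<^sub>L basis k)" if "i \<in> gens" "j \<in> gens" for i j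
    using basis_times_x[OF that(1)] basis_times_y[OF that(1)] basis_times_v2[OF that(1)] basis_times_other[OF that] basis_Y[of 1] basis_E1 basis_X
    by (cases "j = Xg"; cases "j = Eg 1"; cases "j = Yg 1") (simp_all add: lincomb_def)
qed (use span_basis basis_independent in simp_all)

end

section \<open>The classification\<close>

theorem theorem4p9:
  fixes L :: "'v::ab_group_add superalgebra" and N :: "'v set" and n :: nat
  assumes "n \<ge> 3"
    and "leibniz_superalgebra L"
    and "finite_dim L"
    and "super_solvable L"
    and "\<not> super_nilpotent L"
    and "is_nilradical L N"
    and "superalgebra_isomorphic (restrict_to L N) (M_superalgebra n)"
  shows "superalgebra_isomorphic L (SM_superalgebra n)"
proof -
  interpret leibniz_super L by standard fact
  have "graded_ideal L N" "product_space L S S \<subseteq> N"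
    using assms(6) by (auto simp: is_nilradical_def nilradical_candidate_def)
  then obtain y f where radical: "filiform_radical L y f (2 * n - 1)" and N: "flag y f 1 = N"
    using filiform_radical_of_M assms(1,7) by blast
  interpret I: filiform_radical L y f "2 * n - 1" by (rule radical)
  obtain x where x: "x \<in> part L 0" "y \<bullet> x - y \<in> flag y f 2" "x \<notin> N"
      "\<And>w. w \<in> S \<Longrightarrow> \<exists>c. w - c *\<^sub>L x \<in> N"
    using I.exists_toral_element assms(5,6) unfolding N by blast
  \<comment> \<open>only right multiplication by \<open>x\<close> matters for the choice of \<open>y'\<close> and \<open>f'\<close>; the left products are normalized afterwards by changing \<open>x\<close>\<close>
  obtain y' f' where radical': "filiform_radical L y' f' (2 * n - 1)" and N': "flag y' f' 1 = N"
    and eigen: "y' \<bullet> x = y'" "f' \<bullet> x = 2 *\<^sub>L f'"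
    using I.diagonalize[OF x(1,2)] unfolding N by blast
  interpret J: filiform_radical L y' f' "2 * n - 1" by (rule radical')
  obtain x' where x': "x' \<in> part L 0" "x' - x \<in> N" "y' \<bullet> x' = y'" "f' \<bullet> x' = 2 *\<^sub>L f'"
      "x' \<bullet> x' = 0" "x' \<bullet> f' = 0" "x' \<bullet> y' = - y'"
    using J.normalize_toral_element[OF x(1) eigen] unfolding N' by blast
  have N_diff: "u - c *\<^sub>L w \<in> N" if "u \<in> N" "w \<in> N" for u w c
    using I.G_diff[of u 1 "c *\<^sub>L w"] I.G_scale[of w 1 c] that unfolding N by blast
  interpret K: diagonal_extension L y' f' "2 * n - 1" n x'
  proof
    show "2 * n - 1 = 2 * n - 1" "n \<ge> 3" "x' \<in> part L 0" by (rule refl) fact+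
    show "x' \<notin> flag y' f' 1"
      using N_diff[of x' "x' - x" 1] x'(2) x(3) unfolding N' by auto
    show "\<exists>c. w - c *\<^sub>L x' \<in> flag y' f' 1" if w: "w \<in> S" for w
    proof -
      obtain c where "w - c *\<^sub>L x \<in> N" using x(4)[OF w] by blast
      then have "w - c *\<^sub>L x - c *\<^sub>L (x' - x) \<in> N" using x'(2) by (rule N_diff)
      then have "w - c *\<^sub>L x' \<in> N" by (simp add: scale_right_diff_distrib)
      then show ?thesis unfolding N' by blast
    qed
  qed (use x' in auto)
  show ?thesis by (rule K.isomorphic_SM)
qed

end
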